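(* Let $g:\mathbb{R}^n\to\mathbb{R}$ and $q=(q_1,\dots,q_m):\mathbb{R}^n\to\mathbb{R}^m$ be twice continuously differentiable, let $\Gamma=\{x: q_i(x)\le 0,\ i=1,\dots,m\}$, and consider the problem of minimizing $g(x)$ subject to $x\in\Gamma$. Let $\bar x\in\Gamma$ be a stationary point of this problem and let $\kappa,\gamma>0$ be real numbers. Suppose that MSCQ is fulfilled at $\bar x$, that $\gamma>\operatorname{subreg}Q_q(\bar x|0)$, and that the following second-order condition holds: $$\langle\nabla^2_{xx}L(\bar x,\lambda)w,w\rangle>\frac1\kappa\|w\|^2\quad\text{whenever } w\ne0 \text{ with } \langle\nabla q_i(\bar x),w\rangle=0,\ i\in I^+(\lambda),\ \text{and } \lambda\in\Delta(\bar x),$$ where $$\Delta(\bar x):=\Big(\bigcup_{0\ne v\in K(\bar x,-\nabla g(\bar x))}\Lambda(\bar x,-\nabla g(\bar x);v)\Big)\cap\gamma\|\nabla g(\bar x)\|\,\mathbb{B}_{\mathbb{R}^m}.$$ Then $\bar x$ is a tilt-stable local minimizer of the problem with modulus $\kappa$. Furthermore, $$\operatorname{tilt}(g,q,\bar x)\le\sup\Big\{\frac{\|w\|^2}{\langle\nabla^2_{xx}L(\bar x,\lambda)w,w\rangle}\ \Big|\ \lambda\in\Delta(\bar x),\ \langle\nabla q_i(\bar x),w\rangle=0,\ i\in I^+(\lambda)\Big\}<\infty,$$ with the conventions $0/0:=0$ and $\sup\emptyset:=0$.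
   Context: Norms are Euclidean; $\mathbb{B}_r(a)$ is the closed ball of radius $r$ about $a$; $\mathbb{B}_{\mathbb{R}^m}$ is the closed unit ball of $\mathbb{R}^m$; $d(\cdot\,;\cdot)$ is the distance from a point to a set; $\mathbb{R}^m_-$ and $\mathbb{R}^m_+$ are the nonpositive and nonnegative orthants. Active indices: $I(x)=\{i:q_i(x)=0\}$ for $x\in\Gamma$; $I^+(\lambda)=\{i:\lambda_i>0\}$ for $\lambda\in\mathbb{R}^m_+$. Lagrangian: $L(x,\lambda)=g(x)+\lambda^Tq(x)$. A point $x\in\Gamma$ is stationary if there is $\lambda\in\mathbb{R}^m_+$ with $\nabla_xL(x,\lambda)=0$ and $\lambda_iq_i(x)=0$ for all $i$. Critical cone: $K(x,x^* )=T_\Gamma(x)\cap\{w:\langle x^*,w\rangle=0\}$, where $T_\Gamma(x)=\{v:\exists\,t_k\downarrow0,\ v_k\to v,\ x+t_kv_k\in\Gamma\}$ is the tangent cone. Multipliers: $\Lambda(x,x^* )=\{\lambda\in\mathbb{R}^m_+:\nabla q(x)^T\lambda=x^*,\ \lambda_i=0\text{ for }i\notin I(x)\}$. For $v\in\mathbb{R}^n$, $\Lambda(x,x^*;v)$ is the set of optimal solutions of the linear program: minimize $-v^T\nabla^2(\lambda^Tq)(x)v$ over $\lambda\in\Lambda(x,x^* )$. MSCQ (metric subregularity constraint qualification) holds at $\bar x\in\Gamma$ if there are a neighborhood $U$ of $\bar x$ and $c>0$ such that $d(x;\Gamma)\le c\,d(q(x);\mathbb{R}^m_-)$ for all $x\in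 U$. With $Q_q(x)=q(x)-\mathbb{R}^m_-$, the modulus $\operatorname{subreg}Q_q(\bar x|0)$ is the infimum of all such $c$ (over all neighborhoods $U$). Tilt stability: $\bar x\in\Gamma$ is a tilt-stable local minimizer of the problem with modulus $\kappa>0$ if there is $\gamma_0>0$ such that the mapping $v\mapsto\operatorname{argmin}\{g(x)-\langle v,x\rangle: x\in\Gamma\cap\mathbb{B}_{\gamma_0}(\bar x)\}$ is single-valued and Lipschitz continuous with constant $\kappa$ on some neighborhood of $0\in\mathbb{R}^n$, with value $\bar x$ at $v=0$. The exact modulus $\operatorname{tilt}(g,q,\bar x)$ is the infimum of all $\kappa>0$ such that $\bar x$ is a tilt-stable local minimizer with modulus $\kappa$. *)

theory Defs
  imports "HOL-Analysis.Analysis"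
begin

definition grad :: "(real^'n \<Rightarrow> real) \<Rightarrow> real^'n \<Rightarrow> real^'n" where
  "grad f x = (THE D. GDERIV f x :> D)"

definition hessian :: "(real^'n \<Rightarrow> real) \<Rightarrow> real^'n \<Rightarrow> real^'n^'n" where
  "hessian f x = jacobian (grad f) (at x)"

definition C2 :: "(real^'n \<Rightarrow> real) \<Rightarrow> bool" where
  "C2 f \<longleftrightarrow> (\<forall>x. f differentiable (at x)) \<and> (\<forall>x. grad f differentiable (at x))
     \<and> continuous_on UNIV (hessian f)"

lemma gderiv_grad:
  fixes f :: "real^'n \<Rightarrow> real"
  assumes "f differentiable (at x)"
  shows "GDERIV f x :> grad f x"
proof -
  have lin: "(f has_derivative frechet_derivative f (at x)) (at x)"
    using assms frechet_derivative_works by blast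
  define D where "D = (\<Sum>b\<in>Basis. frechet_derivative f (at x) b *\<^sub>R b)"
  have "frechet_derivative f (at x) h = inner h D" for h
  proof -
    have "frechet_derivative f (at x) h
        = frechet_derivative f (at x) (\<Sum>b\<in>Basis. inner h b *\<^sub>R b)"
      by (simp only: euclidean_representation)
    also have "\<dots> = (\<Sum>b\<in>Basis. inner h b * frechet_derivative f (at x) b)"
      using has_derivative_linear[OF lin] by (simp only: linear_sum linear_cmul real_scaleR_def)
    finally show ?thesis
      by (simp only: D_def inner_sum_right inner_scaleR_right mult.commute)
  qed
  then have "frechet_derivative f (at x) = (\<lambda>h. inner h D)" by blast
  with lin have D: "GDERIV f x :> D" by (simp add: gderiv_def)
  have "D' = D" if "GDERIV f x :> D'" for D'
  proof -
    have "(\<lambda>h. inner h D') = (\<lambda>h. inner h D)"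
      using that D unfolding gderiv_def by (rule has_derivative_unique)
    then have "\<forall>h. inner h D' = inner h D" by (rule fun_cong[THEN allI])
    then show ?thesis by (simp only: vector_eq_ldot)
  qed
  with D show ?thesis unfolding grad_def by (rule theI)
qed

lemma C2_derivatives:
  assumes "C2 f"
  shows "(f has_derivative (\<lambda>h. inner h (grad f x))) (at x)"
    and "(grad f has_derivative (\<lambda>h. hessian f x *v h)) (at x)"
proof -
  show "(f has_derivative (\<lambda>h. inner h (grad f x))) (at x)"
    using assms gderiv_grad[of f x] unfolding C2_def gderiv_def by blast
  have "grad f differentiable (at x)" using assms unfolding C2_def by blast
  then show "(grad f has_derivative (\<lambda>h. hessian f x *v h)) (at x)"
    unfolding hessian_def using jacobian_works by blast
qed

definition nonneg_orthant :: "(real^'m) set" where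
  "nonneg_orthant = {y. \<forall>i. 0 \<le> y $ i}"

definition nonpos_orthant :: "(real^'m) set" where
  "nonpos_orthant = {y. \<forall>i. y $ i \<le> 0}"

definition feasible :: "(real^'n \<Rightarrow> real^'m) \<Rightarrow> (real^'n) set" where
  "feasible q = {x. \<forall>i. q x $ i \<le> 0}"

definition active :: "(real^'n \<Rightarrow> real^'m) \<Rightarrow> real^'n \<Rightarrow> 'm set" where
  "active q x = {i. q x $ i = 0}"

definition pos_indices :: "real^'m \<Rightarrow> 'm set" where
  "pos_indices l = {i. 0 < l $ i}"

definition lagrangian ::
  "(real^'n \<Rightarrow> real) \<Rightarrow> (real^'n \<Rightarrow> real^'m) \<Rightarrow> real^'n \<Rightarrow> real^'m \<Rightarrow> real" where
  "lagrangian g q x l = g x + l \<bullet> q x"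

definition stationary :: "(real^'n \<Rightarrow> real) \<Rightarrow> (real^'n \<Rightarrow> real^'m) \<Rightarrow> real^'n \<Rightarrow> bool" where
  "stationary g q x \<longleftrightarrow> x \<in> feasible q \<and>
     (\<exists>l\<in>nonneg_orthant. grad (\<lambda>y. lagrangian g q y l) x = 0 \<and> (\<forall>i. l $ i * q x $ i = 0))"

definition tangent_cone :: "(real^'n) set \<Rightarrow> real^'n \<Rightarrow> (real^'n) set" where
  "tangent_cone S x = {v. \<exists>(t :: nat \<Rightarrow> real) (u :: nat \<Rightarrow> real^'n).
     (\<forall>k. 0 < t k) \<and> t \<longlonglongrightarrow> 0 \<and> u \<longlonglongrightarrow> v \<and> (\<forall>k. x + t k *\<^sub>R u k \<in> S)}"

definition critical_cone ::
  "(real^'n \<Rightarrow> real^'m) \<Rightarrow> real^'n \<Rightarrow> real^'n \<Rightarrow> (real^'n) set" where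
  "critical_cone q x xs = tangent_cone (feasible q) x \<inter> {w. xs \<bullet> w = 0}"

definition multipliers ::
  "(real^'n \<Rightarrow> real^'m) \<Rightarrow> real^'n \<Rightarrow> real^'n \<Rightarrow> (real^'m) set" where
  "multipliers q x xs = {l \<in> nonneg_orthant.
     transpose (jacobian q (at x)) *v l = xs \<and> (\<forall>i. i \<notin> active q x \<longrightarrow> l $ i = 0)}"

definition dir_multipliers ::
  "(real^'n \<Rightarrow> real^'m) \<Rightarrow> real^'n \<Rightarrow> real^'n \<Rightarrow> real^'n \<Rightarrow> (real^'m) set" where
  "dir_multipliers q x xs v = {l. is_arg_min
     (\<lambda>l. - (v \<bullet> (hessian (\<lambda>y. l \<bullet> q y) x *v v))) (\<lambda>l. l \<in> multipliers q x xs) l}"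

definition mscq_const :: "(real^'n \<Rightarrow> real^'m) \<Rightarrow> real^'n \<Rightarrow> real \<Rightarrow> bool" where
  "mscq_const q x c \<longleftrightarrow> 0 < c \<and> (\<exists>U. open U \<and> x \<in> U \<and>
     (\<forall>y\<in>U. infdist y (feasible q) \<le> c * infdist (q y) nonpos_orthant))"

definition MSCQ :: "(real^'n \<Rightarrow> real^'m) \<Rightarrow> real^'n \<Rightarrow> bool" where
  "MSCQ q x \<longleftrightarrow> x \<in> feasible q \<and> (\<exists>c. mscq_const q x c)"

text \<open>Moduli are extended reals, so that the infimum of the empty set is \<open>\<infinity>\<close>.\<close>

definition subreg :: "(real^'n \<Rightarrow> real^'m) \<Rightarrow> real^'n \<Rightarrow> ereal" where
  "subreg q x = Inf (ereal ` {c. mscq_const q x c})"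

definition tilt_argmin ::
  "(real^'n \<Rightarrow> real) \<Rightarrow> (real^'n \<Rightarrow> real^'m) \<Rightarrow> real^'n \<Rightarrow> real \<Rightarrow> real^'n \<Rightarrow> (real^'n) set" where
  "tilt_argmin g q xbar r v =
     {x. is_arg_min (\<lambda>x. g x - v \<bullet> x) (\<lambda>x. x \<in> feasible q \<inter> cball xbar r) x}"

definition tilt_stable ::
  "(real^'n \<Rightarrow> real) \<Rightarrow> (real^'n \<Rightarrow> real^'m) \<Rightarrow> real^'n \<Rightarrow> real \<Rightarrow> bool" where
  "tilt_stable g q xbar \<kappa> \<longleftrightarrow> 0 < \<kappa> \<and> xbar \<in> feasible q \<and>
     (\<exists>r>0. \<exists>V s. open V \<and> 0 \<in> V \<and> (\<forall>v\<in>V. tilt_argmin g q xbar r v = {s v}) \<and>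
        \<kappa>-lipschitz_on V s \<and> s 0 = xbar)"

definition tilt :: "(real^'n \<Rightarrow> real) \<Rightarrow> (real^'n \<Rightarrow> real^'m) \<Rightarrow> real^'n \<Rightarrow> ereal" where
  "tilt g q xbar = Inf (ereal ` {\<kappa>. tilt_stable g q xbar \<kappa>})"

definition Delta ::
  "(real^'n \<Rightarrow> real) \<Rightarrow> (real^'n \<Rightarrow> real^'m) \<Rightarrow> real \<Rightarrow> real^'n \<Rightarrow> (real^'m) set" where
  "Delta g q \<gamma> x =
     (\<Union>v \<in> critical_cone q x (- grad g x) - {0}. dir_multipliers q x (- grad g x) v)
     \<inter> cball 0 (\<gamma> * norm (grad g x))"

definition sosc_subspace :: "(real^'n \<Rightarrow> real^'m) \<Rightarrow> real^'n \<Rightarrow> real^'m \<Rightarrow> (real^'n) set" where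
  "sosc_subspace q x l = {w. \<forall>i\<in>pos_indices l. grad (\<lambda>y. q y $ i) x \<bullet> w = 0}"

definition lagr_quad ::
  "(real^'n \<Rightarrow> real) \<Rightarrow> (real^'n \<Rightarrow> real^'m) \<Rightarrow> real^'n \<Rightarrow> real^'m \<Rightarrow> real^'n \<Rightarrow> real" where
  "lagr_quad g q x l w = (hessian (\<lambda>y. lagrangian g q y l) x *v w) \<bullet> w"

text \<open>The division is that of the extended reals, where \<open>0 / 0 = 0\<close> and \<open>a / 0 = \<infinity>\<close> for
  \<open>a > 0\<close>. The empty supremum is set to \<open>0\<close> by hand, since it is \<open>-\<infinity>\<close> in \<^typ>\<open>ereal\<close>.\<close>

definition tilt_bound ::
  "(real^'n \<Rightarrow> real) \<Rightarrow> (real^'n \<Rightarrow> real^'m) \<Rightarrow> real \<Rightarrow> real^'n \<Rightarrow> ereal" where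
  "tilt_bound g q \<gamma> x =
     (let Q = {ereal ((norm w)\<^sup>2) / ereal (lagr_quad g q x l w) | l w.
                 l \<in> Delta g q \<gamma> x \<and> w \<in> sosc_subspace q x l}
      in if Q = {} then 0 else Sup Q)"

end

theory Submission
  imports Defs
begin

text \<open>
  The proof rests on one estimate: uniform quadratic growth. Let \<open>u \<noteq> xbar\<close> be feasible and stationary
  for the tilt \<open>v\<close>, with \<open>u\<close> near \<open>xbar\<close> and \<open>v\<close> near 0. Then
  \<open>g x \<ge> g u + v \<bullet> (x - u) + \<parallel>x - u\<parallel>\<^sup>2 / (2 \<kappa>)\<close> for all feasible \<open>x\<close> near \<open>xbar\<close> (\<open>kkt_growth\<close>). Adding
  this inequality for two tilts and their minimizers gives the Lipschitz estimate with constant \<open>\<kappa>\<close>.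

  The growth estimate is shown by contradiction along sequences, and needs two things from the
  multipliers: that they converge, and that their limit belongs to \<open>Delta\<close>. Metric subregularity gives
  multipliers bounded by the subregularity constant times the norm of the gradient
  (\<open>mscq_multiplier\<close>), by linearizing the objective together with the distance to the feasible set and
  separating. The direction in which the points \<open>u\<close> approach \<open>xbar\<close> is critical, and the limit
  multiplier is optimal for the linear program of this direction (\<open>kkt_limit_direction\<close>). In the
  direction of \<open>x - u\<close>, either the constraints with positive limit multiplier contribute a term of first
  order, or the direction satisfies the second-order condition.

  The point \<open>xbar\<close> itself may be stationary for tilts \<open>v \<noteq> 0\<close>, and then no approach direction is at
  hand. Growth is not claimed there. Instead, \<open>xbar\<close> is a strict local minimizer for \<open>v = 0\<close>
  (\<open>strict_local_min\<close>), which keeps the minimizers for small tilts away from the boundary of the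
  localizing ball. Being unique, they depend continuously on the tilt, and the Lipschitz estimate
  between tilts whose minimizers differ from \<open>xbar\<close> extends along segments to all small tilts
  (\<open>lipschitz_off_value\<close>).

  The bound on the exact modulus follows by applying the first part with every \<open>\<kappa>'\<close> above the supremum,
  since the second-order condition for such a \<open>\<kappa>'\<close> is a reformulation of that inequality.
\<close>

section \<open>Second-order expansions of objective and constraints\<close>

lemma grad_eqI:
  fixes f :: "real^'n \<Rightarrow> real"
  assumes "(f has_derivative (\<lambda>h. inner h D)) (at x)"
  shows "grad f x = D"
proof -
  have "(f has_derivative (\<lambda>h. inner h (grad f x))) (at x)"
    using gderiv_grad[of f x] assms unfolding gderiv_def differentiable_def by blast
  from has_derivative_unique[OF this assms] show ?thesis
    by (metis vector_eq_ldot)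
qed

lemma hessian_eqI:
  fixes f :: "real^'n \<Rightarrow> real"
  assumes "(grad f has_derivative (\<lambda>h. A *v h)) (at x)"
  shows "hessian f x = A"
proof -
  have "grad f differentiable (at x)" using assms unfolding differentiable_def by blast
  then have "(grad f has_derivative (\<lambda>h. hessian f x *v h)) (at x)"
    unfolding hessian_def using jacobian_works by blast
  from has_derivative_unique[OF this assms] show ?thesis
    by (metis matrix_eq)
qed

text \<open>
  This is \<open>\<nabla>q(x)\<^sup>T l\<close>, written as a combination of the gradients of the components.
\<close>

definition comb_grad :: "(real^'n \<Rightarrow> real^'m) \<Rightarrow> real^'n \<Rightarrow> real^'m \<Rightarrow> real^'n" where
  "comb_grad q x l = (\<Sum>i\<in>UNIV. l $ i *\<^sub>R grad (\<lambda>y. q y $ i) x)"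

lemma comb_grad_inner: "comb_grad q x l \<bullet> h = (\<Sum>i\<in>UNIV. l $ i * (grad (\<lambda>y. q y $ i) x \<bullet> h))"
  by (simp add: comb_grad_def inner_sum_left)

lemma linear_comb_grad: "linear (comb_grad q x)"
  by (rule linearI)
    (simp_all add: comb_grad_def scaleR_left_distrib sum.distrib scaleR_sum_right)

lemma sum_scaleR_matrix_vector:
  "(\<Sum>i\<in>I. c i *\<^sub>R (H i :: real^'n^'k)) *v z = (\<Sum>i\<in>I. c i *\<^sub>R (H i *v z))"
  by (induction I rule: infinite_finite_induct)
    (simp_all add: matrix_vector_mult_add_rdistrib scaleR_matrix_vector_assoc)

lemma comb_has_derivative:
  fixes q :: "real^'n \<Rightarrow> real^'m"
  assumes q: "\<And>i. C2 (\<lambda>x. q x $ i)"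
  shows "((\<lambda>y. l \<bullet> q y) has_derivative (\<lambda>h. h \<bullet> comb_grad q x l)) (at x)"
  unfolding comb_grad_def inner_vec_def[of l]
  by (auto intro!: derivative_eq_intros C2_derivatives(1)[OF q] simp: inner_sum_right)

lemma C2_comb:
  fixes q :: "real^'n \<Rightarrow> real^'m"
  assumes q: "\<And>i. C2 (\<lambda>x. q x $ i)"
  shows grad_comb: "grad (\<lambda>y. l \<bullet> q y) x = comb_grad q x l"
    and hessian_comb: "hessian (\<lambda>y. l \<bullet> q y) x
      = (\<Sum>i\<in>UNIV. l $ i *\<^sub>R hessian (\<lambda>y. q y $ i) x)"
    and grad_lagrangian: "C2 g \<Longrightarrow>
      grad (\<lambda>y. lagrangian g q y l) x = grad g x + comb_grad q x l"
    and hessian_lagrangian: "C2 g \<Longrightarrow> hessian (\<lambda>y. lagrangian g q y l) x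
      = hessian g x + (\<Sum>i\<in>UNIV. l $ i *\<^sub>R hessian (\<lambda>y. q y $ i) x)"
proof -
  note d1 = comb_has_derivative[OF q, of l]
  show g1: "grad (\<lambda>y. l \<bullet> q y) x = comb_grad q x l" for x
    by (rule grad_eqI[OF d1])
  have d2: "((\<lambda>x. comb_grad q x l) has_derivative
      (\<lambda>h. (\<Sum>i\<in>UNIV. l $ i *\<^sub>R hessian (\<lambda>y. q y $ i) x) *v h)) (at x)"
    unfolding comb_grad_def sum_scaleR_matrix_vector
    by (auto intro!: derivative_eq_intros C2_derivatives(2)[OF q])
  then show "hessian (\<lambda>y. l \<bullet> q y) x = (\<Sum>i\<in>UNIV. l $ i *\<^sub>R hessian (\<lambda>y. q y $ i) x)"
    by (intro hessian_eqI) (simp add: ext[of "grad (\<lambda>y. l \<bullet> q y)" "\<lambda>x. comb_grad q x l", OF g1])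
  assume g: "C2 g"
  show g2: "grad (\<lambda>y. lagrangian g q y l) x = grad g x + comb_grad q x l" for x
    unfolding lagrangian_def using has_derivative_add[OF C2_derivatives(1)[OF g] d1]
    by (intro grad_eqI) (simp add: inner_add_right)
  show "hessian (\<lambda>y. lagrangian g q y l) x
      = hessian g x + (\<Sum>i\<in>UNIV. l $ i *\<^sub>R hessian (\<lambda>y. q y $ i) x)"
    unfolding lagrangian_def[abs_def]
    by (rule hessian_eqI, subst ext[of "grad _", OF g2[unfolded lagrangian_def]])
      (auto intro!: derivative_eq_intros C2_derivatives(2)[OF g] d2
        simp: matrix_vector_mult_add_rdistrib)
qed

lemma quad_comb:
  "((\<Sum>i\<in>UNIV. l $ i *\<^sub>R (H i :: real^'n^'n)) *v z) \<bullet> z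
     = (\<Sum>i\<in>UNIV. (l :: real^'m) $ i * ((H i *v z) \<bullet> z))"
  by (simp add: sum_scaleR_matrix_vector inner_sum_left)

lemma transpose_jacobian:
  fixes q :: "real^'n \<Rightarrow> real^'m"
  assumes q: "\<And>i. C2 (\<lambda>x. q x $ i)"
  shows "transpose (jacobian q (at x)) *v l = comb_grad q x l"
proof -
  have "(q has_derivative (\<lambda>h. \<chi> i. h \<bullet> grad (\<lambda>y. q y $ i) x)) (at x)"
    using C2_derivatives(1)[OF q]
    by (subst has_derivative_componentwise_within)
       (auto simp: Basis_vec_def inner_axis)
  then have "frechet_derivative q (at x) = (\<lambda>h. \<chi> i. h \<bullet> grad (\<lambda>y. q y $ i) x)"
    using frechet_derivative_at by metis
  then have "jacobian q (at x) $ i $ j = grad (\<lambda>y. q y $ i) x $ j" for i j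
    by (simp add: jacobian_def matrix_def cart_eq_inner_axis[of "grad _ _"] inner_commute)
  then show ?thesis
    by (simp add: comb_grad_def vec_eq_iff matrix_vector_mult_def transpose_def mult.commute)
qed

lemma C2_continuous:
  assumes "C2 f"
  shows "continuous_on UNIV f" "continuous_on UNIV (grad f)" "continuous_on UNIV (hessian f)"
  using assms unfolding C2_def
  by (auto simp: continuous_on_eq_continuous_at differentiable_imp_continuous_within)

lemma C2_taylor:
  fixes f :: "real^'n \<Rightarrow> real"
  assumes f: "C2 f"
  obtains t where "0 < t" "t < 1"
    "f x - f u - grad f u \<bullet> (x - u)
       = (hessian f (u + t *\<^sub>R (x - u)) *v (x - u)) \<bullet> (x - u) / 2"
proof -
  let ?d = "x - u"
  define D where "D = (\<lambda>m::nat. \<lambda>t. if m = 0 then f (u + t *\<^sub>R ?d) else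
     if m = 1 then grad f (u + t *\<^sub>R ?d) \<bullet> ?d else (hessian f (u + t *\<^sub>R ?d) *v ?d) \<bullet> ?d)"
  have lin: "((\<lambda>t. u + t *\<^sub>R ?d) has_derivative (\<lambda>h. h *\<^sub>R ?d)) (at t)" for t :: real
    by (auto intro!: derivative_eq_intros)
  have 0: "DERIV (D 0) t :> D 1 t" for t
    using has_derivative_compose[OF lin C2_derivatives(1)[OF f]]
    by (simp add: D_def has_field_derivative_def mult.commute inner_commute)
      (simp add: mult_commute_abs)
  have 1: "DERIV (D 1) t :> D 2 t" for t
  proof -
    have "((\<lambda>t. grad f (u + t *\<^sub>R ?d) \<bullet> ?d) has_derivative
        (\<lambda>h. (hessian f (u + t *\<^sub>R ?d) *v (h *\<^sub>R ?d)) \<bullet> ?d)) (at t)"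
      by (intro has_derivative_inner_left has_derivative_compose[OF lin C2_derivatives(2)[OF f]])
    then show ?thesis
      by (simp add: D_def has_field_derivative_def matrix_vector_mult_scaleR mult_commute_abs)
  qed
  have "\<exists>t. 0 < t \<and> t < 1 \<and>
     D 0 1 = (\<Sum>m<2. D m 0 / fact m * 1 ^ m) + D 2 t / fact 2 * 1 ^ 2"
    using 0 1 by (intro Maclaurin) (auto simp: less_Suc_eq numeral_2_eq_2)
  then obtain t where "0 < t" "t < 1" "D 0 1 = D 0 0 + D 1 0 + D 2 t / 2"
    by (auto simp: numeral_2_eq_2)
  with that[of t] show thesis by (simp add: D_def)
qed

text \<open>
  Both end points of the increment move here. A pointwise second-order expansion at \<open>a\<close> would only
  cover increments that start in \<open>a\<close>; continuity of the Hessian gives the same limit for all pairs of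
  points that tend to \<open>a\<close>, which is what makes the growth estimate below uniform in its base point.
\<close>

lemma second_order_limit:
  fixes f :: "real^'n \<Rightarrow> real"
  assumes f: "C2 f" and x: "x \<longlonglongrightarrow> a" and u: "u \<longlonglongrightarrow> a"
    and z: "(\<lambda>k. (x k - u k) /\<^sub>R norm (x k - u k)) \<longlonglongrightarrow> z"
  shows "(\<lambda>k. (f (x k) - f (u k) - grad f (u k) \<bullet> (x k - u k)) / (norm (x k - u k))\<^sup>2)
     \<longlonglongrightarrow> (hessian f a *v z) \<bullet> z / 2"
proof -
  have "\<exists>t. 0 < t \<and> t < 1 \<and> f (x k) - f (u k) - grad f (u k) \<bullet> (x k - u k)
       = (hessian f (u k + t *\<^sub>R (x k - u k)) *v (x k - u k)) \<bullet> (x k - u k) / 2" for k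
    using C2_taylor[OF f, of "x k" "u k"] by metis
  then obtain t where t: "\<And>k. 0 < t k \<and> t k < 1"
    and eq: "\<And>k. f (x k) - f (u k) - grad f (u k) \<bullet> (x k - u k)
       = (hessian f (u k + t k *\<^sub>R (x k - u k)) *v (x k - u k)) \<bullet> (x k - u k) / 2"
    by metis
  have "(\<lambda>k. t k *\<^sub>R (x k - u k)) \<longlonglongrightarrow> 0"
  proof (rule Lim_null_comparison)
    show "\<forall>\<^sub>F k in sequentially. norm (t k *\<^sub>R (x k - u k)) \<le> norm (x k - u k)"
      using t by (intro always_eventually allI)
        (simp add: mult_left_le_one_le less_imp_le abs_of_pos)
    show "(\<lambda>k. norm (x k - u k)) \<longlonglongrightarrow> 0"
      using tendsto_norm[OF tendsto_diff[OF x u]] by simp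
  qed
  then have "(\<lambda>k. u k + t k *\<^sub>R (x k - u k)) \<longlonglongrightarrow> a"
    using tendsto_add[OF u, of "\<lambda>k. t k *\<^sub>R (x k - u k)" 0] by simp
  then have H: "(\<lambda>k. hessian f (u k + t k *\<^sub>R (x k - u k))) \<longlonglongrightarrow> hessian f a"
    by (rule continuous_on_tendsto_compose[OF C2_continuous(3)[OF f]]) simp_all
  let ?z = "\<lambda>k. (x k - u k) /\<^sub>R norm (x k - u k)"
  have "(\<lambda>k. (hessian f (u k + t k *\<^sub>R (x k - u k)) *v ?z k) \<bullet> ?z k / 2)
     \<longlonglongrightarrow> (hessian f a *v z) \<bullet> z / 2"
    unfolding matrix_vector_mult_def by (intro tendsto_intros H z) simp
  moreover have "(hessian f (u k + t k *\<^sub>R (x k - u k)) *v ?z k) \<bullet> ?z k / 2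
    = (f (x k) - f (u k) - grad f (u k) \<bullet> (x k - u k)) / (norm (x k - u k))\<^sup>2" for k
  proof -
    have "inverse n * (inverse n * c) / 2 = c / 2 / n\<^sup>2" for n c :: real
      by (cases "n = 0") (simp_all add: field_simps power2_eq_square)
    then show ?thesis
      by (simp only: eq[of k] matrix_vector_mult_scaleR inner_scaleR_right inner_scaleR_left)
  qed
  ultimately show ?thesis by (simp only:)
qed

text \<open>
  The second-order remainder, divided by the norm of the increment only, vanishes in the limit.
\<close>

lemma first_order_limit:
  fixes f :: "real^'n \<Rightarrow> real"
  assumes f: "C2 f" and x: "x \<longlonglongrightarrow> a" and u: "u \<longlonglongrightarrow> a"
    and z: "(\<lambda>k. (x k - u k) /\<^sub>R norm (x k - u k)) \<longlonglongrightarrow> z"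
  shows "(\<lambda>k. (f (x k) - f (u k)) / norm (x k - u k)) \<longlonglongrightarrow> grad f a \<bullet> z"
proof -
  let ?n = "\<lambda>k. norm (x k - u k)"
  have G: "(\<lambda>k. grad f (u k)) \<longlonglongrightarrow> grad f a"
    by (rule continuous_on_tendsto_compose[OF C2_continuous(2)[OF f] u]) simp_all
  have N: "?n \<longlonglongrightarrow> 0" using tendsto_norm[OF tendsto_diff[OF x u]] by simp
  have "(\<lambda>k. ?n k * ((f (x k) - f (u k) - grad f (u k) \<bullet> (x k - u k)) / (?n k)\<^sup>2)
      + grad f (u k) \<bullet> ((x k - u k) /\<^sub>R ?n k)) \<longlonglongrightarrow> 0 * ((hessian f a *v z) \<bullet> z / 2) + grad f a \<bullet> z"
    by (intro tendsto_intros N G z second_order_limit f x u)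
  moreover have "?n k * ((f (x k) - f (u k) - grad f (u k) \<bullet> (x k - u k)) / (?n k)\<^sup>2)
      + grad f (u k) \<bullet> ((x k - u k) /\<^sub>R ?n k) = (f (x k) - f (u k)) / ?n k" for k
  proof -
    have "n * ((F - B) / n\<^sup>2) + inverse n * B = F / n" for n F B :: real
      by (cases "n = 0") (simp_all add: power2_eq_square field_simps)
    then show ?thesis by (simp only: inner_scaleR_right)
  qed
  ultimately show ?thesis by simp
qed

section \<open>Multipliers from metric subregularity\<close>

lemma closed_feasible:
  assumes "\<And>i. C2 (\<lambda>x. q x $ i)"
  shows "closed (feasible q)"
proof -
  have "feasible q = (\<Inter>i. {x. q x $ i \<le> 0})" by (auto simp: feasible_def)
  moreover have "closed {x. q x $ i \<le> 0}" for i
    by (intro closed_Collect_le C2_continuous(1)[OF assms] continuous_on_const)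
  ultimately show ?thesis by auto
qed

text \<open>
  The projection of \<open>y\<close> onto the nonpositive orthant leaves the positive part of \<open>y\<close> as residual.
\<close>

lemma infdist_nonpos_orthant_le: "infdist y nonpos_orthant \<le> norm (\<chi> i. max 0 (y $ i))"
proof -
  have "infdist y nonpos_orthant \<le> dist y (\<chi> i. min 0 (y $ i))"
    by (rule infdist_le) (simp add: nonpos_orthant_def)
  also have "y - (\<chi> i. min 0 (y $ i)) = (\<chi> i. max 0 (y $ i))"
    by (simp add: vec_eq_iff max_def min_def)
  then have "dist y (\<chi> i. min 0 (y $ i)) = norm (\<chi> i. max 0 (y $ i))"
    by (simp only: dist_norm)
  finally show ?thesis .
qed

text \<open>
  Why subregularity yields multipliers: move from \<open>u\<close> to \<open>u + t h\<close> and project back onto the feasible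
  set. The projection is feasible, so \<open>\<phi>\<close> does not drop there, and subregularity bounds the projection
  step by \<open>c\<close> times the violation at \<open>u + t h\<close>. Divided by \<open>t\<close>, the violation of an active constraint
  tends to the positive part of its directional derivative, and that of an inactive one vanishes. Thus
  \<open>h = 0\<close> minimizes the sum of the linearized objective and \<open>c \<parallel>a\<parallel>\<close> times the norm of the linearized
  violation.
\<close>

lemma linearized_penalty_minimum:
  fixes q :: "real^'n \<Rightarrow> real^'m"
  assumes q: "\<And>i. C2 (\<lambda>x. q x $ i)" and u: "u \<in> feasible q"
    and c: "0 < c" and U: "open U" "u \<in> U"
    and mscq: "\<And>y. y \<in> U \<Longrightarrow> infdist y (feasible q) \<le> c * infdist (q y) nonpos_orthant"
    and \<phi>: "(\<phi> has_derivative (\<lambda>h. h \<bullet> a)) (at u)"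
    and e: "0 < e" and min: "\<And>y. y \<in> feasible q \<Longrightarrow> dist y u < e \<Longrightarrow> \<phi> u \<le> \<phi> y"
  shows "0 \<le> a \<bullet> h + c * norm a *
     norm (\<chi> i. if i \<in> active q u then max 0 (grad (\<lambda>y. q y $ i) u \<bullet> h) else 0)"
    (is "0 \<le> a \<bullet> h + c * norm a * norm ?P")
proof (rule field_le_epsilon)
  fix \<epsilon> :: real assume \<epsilon>: "0 < \<epsilon>"
  \<comment> \<open>Differentiability of \<open>\<phi>\<close> costs \<open>\<eta>\<close> times the step to the projection, which is at most \<open>2 t \<parallel>h\<parallel>\<close>.\<close>
  define \<eta> where "\<eta> = \<epsilon> / (2 * norm h + 1)"
  have \<eta>: "0 < \<eta>" "\<eta> * (2 * norm h) \<le> \<epsilon>"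
    using \<epsilon> by (auto simp: \<eta>_def field_simps add_pos_nonneg)
  obtain d where d: "0 < d"
    and \<phi>d: "\<And>y. norm (y - u) < d \<Longrightarrow> \<bar>\<phi> y - \<phi> u - (y - u) \<bullet> a\<bar> \<le> \<eta> * norm (y - u)"
    using \<phi> \<eta>(1) unfolding has_derivative_at_alt real_norm_def by blast
  define t :: "nat \<Rightarrow> real" where "t = (\<lambda>k. inverse (real (Suc k)))"
  have t0: "t k > 0" for k by (simp add: t_def)
  have tlim: "t \<longlonglongrightarrow> 0" unfolding t_def by (rule LIMSEQ_inverse_real_of_nat)
  define y where "y = (\<lambda>k. u + t k *\<^sub>R h)"
  have ylim: "y \<longlonglongrightarrow> u"
    unfolding y_def using tendsto_add[OF tendsto_const tendsto_scaleR[OF tlim tendsto_const], of u h]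
    by simp
  have "\<exists>p. p \<in> feasible q \<and> infdist (y k) (feasible q) = dist (y k) p" for k
    using infdist_attains_inf[OF closed_feasible[OF q]] u by (metis empty_iff)
  then obtain p where p: "\<And>k. p k \<in> feasible q"
    and pd: "\<And>k. infdist (y k) (feasible q) = dist (y k) (p k)" by metis
  have pu: "norm (p k - u) \<le> t k * (2 * norm h)" for k
  proof -
    have "dist (y k) (p k) \<le> dist (y k) u" unfolding pd[symmetric] by (rule infdist_le[OF u])
    moreover have "dist (y k) u = t k * norm h" using t0[of k] by (simp add: y_def dist_norm)
    moreover have "dist (p k) u \<le> dist (y k) (p k) + dist (y k) u"
      by (metis dist_commute dist_triangle)
    ultimately show ?thesis by (simp add: dist_norm)
  qed
  have "(\<lambda>k. p k - u) \<longlonglongrightarrow> 0"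
  proof (rule Lim_null_comparison)
    show "(\<lambda>k. t k * (2 * norm h)) \<longlonglongrightarrow> 0" using tendsto_mult_left_zero[OF tlim] .
  qed (use pu in auto)
  then have near: "\<forall>\<^sub>F k in sequentially. norm (p k - u) < min e d"
    using order_tendstoD(2)[OF tendsto_norm_zero, of "\<lambda>k. p k - u" sequentially "min e d"] e d
    by simp
  let ?Q = "\<lambda>k. \<chi> i. max 0 (q (y k) $ i / t k)"
  have Qlim: "?Q \<longlonglongrightarrow> ?P"
  proof (rule vec_tendstoI)
    fix i
    let ?g = "grad (\<lambda>y. q y $ i) u"
    have qlim: "(\<lambda>k. q (y k) $ i) \<longlonglongrightarrow> q u $ i"
      by (rule continuous_on_tendsto_compose[OF C2_continuous(1)[OF q] ylim]) simp_all
    have "(\<lambda>k. max 0 (q (y k) $ i / t k)) \<longlonglongrightarrow> max 0 (?g \<bullet> h)" if i: "i \<in> active q u"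
    proof -
      have "((\<lambda>s. q (u + s *\<^sub>R h) $ i) has_derivative (\<lambda>r. (r *\<^sub>R h) \<bullet> ?g)) (at 0)"
        by (rule has_derivative_compose[of "\<lambda>s. u + s *\<^sub>R h" _ _ _ "\<lambda>y. q y $ i"])
          (auto intro!: derivative_eq_intros C2_derivatives(1)[OF q])
      then have "DERIV (\<lambda>s. q (u + s *\<^sub>R h) $ i) 0 :> ?g \<bullet> h"
        by (simp add: has_field_derivative_def mult_commute_abs inner_commute)
      then have "(\<lambda>s. (q (u + s *\<^sub>R h) $ i - q u $ i) / s) \<midarrow>0\<rightarrow> ?g \<bullet> h"
        by (simp add: DERIV_def)
      moreover have "filterlim t (at 0) sequentially"
        using tlim t0 by (auto simp: filterlim_at less_imp_neq[symmetric])
      ultimately have "(\<lambda>k. (q (u + t k *\<^sub>R h) $ i - q u $ i) / t k) \<longlonglongrightarrow> ?g \<bullet> h"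
        by (rule filterlim_compose)
      then have "(\<lambda>k. q (y k) $ i / t k) \<longlonglongrightarrow> ?g \<bullet> h"
        using i by (simp add: active_def y_def)
      then show ?thesis by (intro tendsto_max tendsto_const)
    qed
    moreover have "(\<lambda>k. max 0 (q (y k) $ i / t k)) \<longlonglongrightarrow> 0" if i: "i \<notin> active q u"
    proof -
      have "q u $ i < 0" using i u by (auto simp: active_def feasible_def order_less_le)
      then have "\<forall>\<^sub>F k in sequentially. q (y k) $ i < 0" using order_tendstoD(2)[OF qlim] by blast
      then have "\<forall>\<^sub>F k in sequentially. max 0 (q (y k) $ i / t k) = 0"
        by eventually_elim (use t0 in \<open>auto intro!: max_absorb1 simp: divide_le_0_iff less_imp_le\<close>)
      then show ?thesis by (rule tendsto_eventually)
    qed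
    ultimately show "(\<lambda>k. ?Q k $ i) \<longlonglongrightarrow> ?P $ i" by simp
  qed
  have "\<forall>\<^sub>F k in sequentially. y k \<in> U"
    using topological_tendstoD[OF ylim U] .
  then have "\<forall>\<^sub>F k in sequentially. 0 \<le> a \<bullet> h + c * norm a * norm (?Q k) + \<epsilon>"
    using near
  proof eventually_elim
    case (elim k)
    have "dist (y k) (p k) \<le> c * infdist (q (y k)) nonpos_orthant"
      using mscq[OF elim(1)] pd by simp
    also have "\<dots> \<le> c * norm (\<chi> i. max 0 (q (y k) $ i))"
      using c by (intro mult_left_mono infdist_nonpos_orthant_le) auto
    also have "(\<chi> i. max 0 (q (y k) $ i)) = t k *\<^sub>R ?Q k"
      using t0[of k] by (simp add: vec_eq_iff max_def zero_le_divide_iff divide_le_0_iff field_simps)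
    also have "norm (t k *\<^sub>R ?Q k) = t k * norm (?Q k)" using t0[of k] by simp
    finally have yp: "norm (p k - y k) \<le> t k * (c * norm (?Q k))"
      by (simp add: dist_norm norm_minus_commute mult.left_commute)
    have "\<phi> u \<le> \<phi> (p k)" using min[OF p] elim(2) by (simp add: dist_norm)
    then have "0 \<le> (p k - u) \<bullet> a + \<eta> * norm (p k - u)"
      using \<phi>d[of "p k"] elim(2) by simp
    also have "(p k - u) \<bullet> a = t k * (a \<bullet> h) + (p k - y k) \<bullet> a"
      by (simp add: y_def inner_diff_right inner_add_right inner_commute)
    also have "(p k - y k) \<bullet> a \<le> t k * (c * norm (?Q k)) * norm a"
      using norm_cauchy_schwarz[of "p k - y k" a] mult_right_mono[OF yp norm_ge_zero[of a]]
      by linarith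
    also have "\<eta> * norm (p k - u) \<le> t k * \<epsilon>"
    proof -
      have "\<eta> * norm (p k - u) \<le> \<eta> * (t k * (2 * norm h))"
        using pu \<eta>(1) by (intro mult_left_mono) auto
      also have "\<dots> = t k * (\<eta> * (2 * norm h))" by simp
      also have "\<dots> \<le> t k * \<epsilon>" using \<eta>(2) t0[of k] by (intro mult_left_mono) auto
      finally show ?thesis .
    qed
    finally have "0 \<le> t k * (a \<bullet> h + c * norm a * norm (?Q k) + \<epsilon>)"
      by (simp add: algebra_simps)
    then show ?case using t0[of k] by (simp add: zero_le_mult_iff)
  qed
  moreover have "(\<lambda>k. a \<bullet> h + c * norm a * norm (?Q k) + \<epsilon>)
      \<longlonglongrightarrow> a \<bullet> h + c * norm a * norm ?P + \<epsilon>"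
    by (intro tendsto_intros Qlim)
  ultimately show "0 \<le> a \<bullet> h + c * norm a * norm ?P + \<epsilon>"
    by (intro tendsto_lowerbound) auto
qed

text \<open>
  The support function, at \<open>h\<close>, of the nonnegative vectors in the ball of radius \<open>c \<parallel>a\<parallel>\<close> that vanish off the
  active set, mapped by \<open>comb_grad q u\<close>, is \<open>c \<parallel>a\<parallel>\<close> times the norm of the linearized violation. So
  the preceding lemma says that \<open>-a\<close> cannot be separated from this compact convex image. The bound on
  the multiplier is therefore the one with the constant of subregularity itself.
\<close>

lemma mscq_multiplier:
  fixes q :: "real^'n \<Rightarrow> real^'m"
  assumes q: "\<And>i. C2 (\<lambda>x. q x $ i)" and u: "u \<in> feasible q"
    and c: "0 < c" and U: "open U" "u \<in> U"
    and mscq: "\<And>y. y \<in> U \<Longrightarrow> infdist y (feasible q) \<le> c * infdist (q y) nonpos_orthant"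
    and \<phi>: "(\<phi> has_derivative (\<lambda>h. h \<bullet> a)) (at u)"
    and e: "0 < e" and min: "\<And>y. y \<in> feasible q \<Longrightarrow> dist y u < e \<Longrightarrow> \<phi> u \<le> \<phi> y"
  obtains l where "l \<in> nonneg_orthant" "\<And>i. l $ i * q u $ i = 0"
    "a + comb_grad q u l = 0" "norm l \<le> c * norm a"
proof -
  define S :: "(real^'m) set" where "S = {l. \<forall>i. 0 \<le> l $ i} \<inter> {l. \<forall>i. i \<notin> active q u \<longrightarrow> l $ i = 0}
     \<inter> cball 0 (c * norm a)"
  have "convex {l::real^'m. \<forall>i. 0 \<le> l $ i}"
    by (auto simp: convex_def)
  moreover have "convex {l::real^'m. \<forall>i. i \<notin> active q u \<longrightarrow> l $ i = 0}"
    by (auto simp: convex_def)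
  ultimately have "convex S" unfolding S_def by (intro convex_Int convex_cball)
  moreover have "compact S"
  proof -
    have "closed {l::real^'m. \<forall>i. 0 \<le> l $ i}"
      by (intro closed_Collect_all closed_Collect_le continuous_intros)
    moreover have "closed {l::real^'m. \<forall>i. i \<notin> active q u \<longrightarrow> l $ i = 0}"
      by (intro closed_Collect_all closed_Collect_imp closed_Collect_eq open_Collect_const
          continuous_intros)
    ultimately show ?thesis unfolding S_def by (intro closed_Int_compact closed_Int) auto
  qed
  ultimately have conv: "convex (comb_grad q u ` S)" and clo: "closed (comb_grad q u ` S)"
    using linear_comb_grad[of q u]
    by (auto intro!: convex_linear_image compact_imp_closed compact_continuous_image
        linear_continuous_on linear_conv_bounded_linear[THEN iffD1])
  have "- a \<in> comb_grad q u ` S"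
  proof (rule ccontr)
    assume "- a \<notin> comb_grad q u ` S"
    then obtain s b where sb: "s \<bullet> (- a) < b" "\<And>l. l \<in> S \<Longrightarrow> b < s \<bullet> comb_grad q u l"
      using separating_hyperplane_closed_point[OF conv clo] by blast
    define h where "h = - s"
    let ?P = "\<chi> i. if i \<in> active q u then max 0 (grad (\<lambda>y. q y $ i) u \<bullet> h) else 0"
    \<comment> \<open>The support function is attained here; for \<open>?P = 0\<close> division by zero gives \<open>l = 0\<close>, as it should.\<close>
    define l where "l = (c * norm a / norm ?P) *\<^sub>R ?P"
    have "l \<in> S"
      using c by (auto simp: S_def l_def divide_simps)
    then have "a \<bullet> h + comb_grad q u l \<bullet> h < 0"
      using sb by (fastforce simp: h_def inner_commute)
    moreover have "comb_grad q u l \<bullet> h = c * norm a * norm ?P"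
    proof -
      have "?P $ i * (grad (\<lambda>y. q y $ i) u \<bullet> h) = ?P $ i * ?P $ i" for i
        by (simp add: max_def)
      then have "comb_grad q u l \<bullet> h
          = (\<Sum>i\<in>UNIV. (c * norm a / norm ?P) * (?P $ i * ?P $ i))"
        unfolding comb_grad_inner l_def vector_scaleR_component
        by (simp only: mult.assoc real_scaleR_def)
      also have "\<dots> = (c * norm a / norm ?P) * (?P \<bullet> ?P)"
        unfolding inner_vec_def by (simp only: sum_distrib_left inner_real_def)
      finally show ?thesis
        by (simp add: dot_square_norm power2_eq_square)
    qed
    ultimately show False
      using linearized_penalty_minimum[OF q u c U mscq \<phi> e min, of h] by linarith
  qed
  then obtain l where "l \<in> S" "comb_grad q u l = - a" by auto
  then show thesis
    by (intro that[of l]) (auto simp: S_def nonneg_orthant_def active_def)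
qed

section \<open>Stationary points of tilted problems and their limits\<close>

text \<open>
  Stationarity of \<open>u\<close> for the problem tilted by \<open>v\<close>. The norm bound is made part of the notion because
  it keeps the multipliers of convergent data in a compact set, and because its limit at \<open>v = 0\<close> is the
  ball that occurs in \<open>Delta\<close>.
\<close>

definition kkt ::
  "(real^'n \<Rightarrow> real) \<Rightarrow> (real^'n \<Rightarrow> real^'m) \<Rightarrow> real \<Rightarrow> real^'n \<Rightarrow> real^'n \<Rightarrow> real^'m \<Rightarrow> bool" where
  "kkt g q c u v l \<longleftrightarrow> u \<in> feasible q \<and> l \<in> nonneg_orthant \<and> (\<forall>i. l $ i * q u $ i = 0) \<and>
     grad g u + comb_grad q u l = v \<and> norm l \<le> c * norm (v - grad g u)"

lemma local_min_kkt:
  fixes q :: "real^'n \<Rightarrow> real^'m"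
  assumes q: "\<And>i. C2 (\<lambda>x. q x $ i)" and u: "u \<in> feasible q"
    and c: "0 < c" and U: "open U" "u \<in> U"
    and mscq: "\<And>y. y \<in> U \<Longrightarrow> infdist y (feasible q) \<le> c * infdist (q y) nonpos_orthant"
    and \<phi>: "(\<phi> has_derivative (\<lambda>h. h \<bullet> (grad g u - v))) (at u)"
    and e: "0 < e" and min: "\<And>y. y \<in> feasible q \<Longrightarrow> dist y u < e \<Longrightarrow> \<phi> u \<le> \<phi> y"
  obtains l where "kkt g q c u v l"
proof -
  obtain l where l: "l \<in> nonneg_orthant" "\<And>i. l $ i * q u $ i = 0"
    "grad g u - v + comb_grad q u l = 0" "norm l \<le> c * norm (grad g u - v)"
    by (rule mscq_multiplier[OF q u c U mscq \<phi> e min], assumption+, rule that)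
  from l(3) have "grad g u + comb_grad q u l = v" by (simp add: algebra_simps)
  with l u show thesis
    by (intro that[of l]) (simp add: kkt_def norm_minus_commute del: mult_eq_0_iff)
qed

lemma comb_second_order_limit:
  fixes q :: "real^'n \<Rightarrow> real^'m"
  assumes q: "\<And>i. C2 (\<lambda>x. q x $ i)" and l: "l \<longlonglongrightarrow> \<mu>"
    and x: "x \<longlonglongrightarrow> a" and u: "u \<longlonglongrightarrow> a"
    and z: "(\<lambda>k. (x k - u k) /\<^sub>R norm (x k - u k)) \<longlonglongrightarrow> z"
  shows "(\<lambda>k. (l k \<bullet> q (x k) - l k \<bullet> q (u k) - comb_grad q (u k) (l k) \<bullet> (x k - u k))
       / (norm (x k - u k))\<^sup>2) \<longlonglongrightarrow> (hessian (\<lambda>y. \<mu> \<bullet> q y) a *v z) \<bullet> z / 2"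
proof -
  have "(\<lambda>k. \<Sum>i\<in>UNIV. l k $ i * ((q (x k) $ i - q (u k) $ i
        - grad (\<lambda>y. q y $ i) (u k) \<bullet> (x k - u k)) / (norm (x k - u k))\<^sup>2))
     \<longlonglongrightarrow> (\<Sum>i\<in>UNIV. \<mu> $ i * ((hessian (\<lambda>y. q y $ i) a *v z) \<bullet> z / 2))"
    by (intro tendsto_sum tendsto_mult tendsto_vec_nth l second_order_limit[OF q x u z])
  moreover have "(\<Sum>i\<in>UNIV. l k $ i * ((q (x k) $ i - q (u k) $ i
        - grad (\<lambda>y. q y $ i) (u k) \<bullet> (x k - u k)) / (norm (x k - u k))\<^sup>2))
     = (l k \<bullet> q (x k) - l k \<bullet> q (u k) - comb_grad q (u k) (l k) \<bullet> (x k - u k))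
       / (norm (x k - u k))\<^sup>2" for k
    unfolding comb_grad_inner inner_vec_def[of "l k"]
    by (simp add: sum_divide_distrib[symmetric] sum_subtractf[symmetric] right_diff_distrib)
  ultimately show ?thesis
    by (simp add: hessian_comb[OF q] quad_comb sum_divide_distrib)
qed

lemma lagrangian_second_order_limit:
  fixes q :: "real^'n \<Rightarrow> real^'m"
  assumes g: "C2 g" and q: "\<And>i. C2 (\<lambda>x. q x $ i)" and l: "l \<longlonglongrightarrow> \<mu>"
    and x: "x \<longlonglongrightarrow> a" and u: "u \<longlonglongrightarrow> a"
    and z: "(\<lambda>k. (x k - u k) /\<^sub>R norm (x k - u k)) \<longlonglongrightarrow> z"
  shows "(\<lambda>k. (g (x k) - g (u k) + (l k \<bullet> q (x k) - l k \<bullet> q (u k))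
       - (grad g (u k) + comb_grad q (u k) (l k)) \<bullet> (x k - u k))
       / (norm (x k - u k))\<^sup>2) \<longlonglongrightarrow> lagr_quad g q a \<mu> z / 2"
proof -
  have "lagr_quad g q a \<mu> z
      = (hessian g a *v z) \<bullet> z + (hessian (\<lambda>y. \<mu> \<bullet> q y) a *v z) \<bullet> z"
    by (simp add: lagr_quad_def hessian_lagrangian[OF q g] hessian_comb[OF q]
        matrix_vector_mult_add_rdistrib inner_add_left)
  then show ?thesis
    using tendsto_add[OF second_order_limit[OF g x u z] comb_second_order_limit[OF q l x u z]]
    by (simp add: add_divide_distrib[symmetric] inner_add_left algebra_simps)
qed

lemma multipliers_iff:
  assumes "\<And>i. C2 (\<lambda>x. q x $ i)"
  shows "l \<in> multipliers q x xs \<longleftrightarrow> l \<in> nonneg_orthant \<and> comb_grad q x l = xs \<and>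
     (\<forall>i. l $ i * q x $ i = 0)"
  unfolding multipliers_def transpose_jacobian[OF assms] active_def by auto

lemma nonneg_inner_feasible:
  assumes "l \<in> nonneg_orthant" "x \<in> feasible q"
  shows "l \<bullet> q x \<le> 0"
  using assms by (auto simp: inner_vec_def nonneg_orthant_def feasible_def
      intro!: sum_nonpos mult_nonneg_nonpos)

lemma complementary_inner:
  fixes l :: "real^'m"
  assumes "\<And>i. l $ i * q x $ i = 0"
  shows "l \<bullet> q x = 0"
  unfolding inner_vec_def inner_real_def by (intro sum.neutral ballI assms)

text \<open>
  Strict positivity of a multiplier persists, so the constraints in \<open>pos_indices\<close> of the limit are
  active along the sequence.
\<close>

lemma eventually_active:
  fixes l :: "nat \<Rightarrow> real^'m"
  assumes l: "l \<longlonglongrightarrow> \<mu>" and i: "i \<in> pos_indices \<mu>"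
    and comp: "\<And>k. l k $ i * q (u k) $ i = 0"
  shows "\<forall>\<^sub>F k in sequentially. 0 < l k $ i \<and> q (u k) $ i = 0"
proof -
  have "\<forall>\<^sub>F k in sequentially. 0 < l k $ i"
    using order_tendstoD(1)[OF tendsto_vec_nth[OF l]] i by (auto simp: pos_indices_def)
  then show ?thesis
    by eventually_elim (use comp in \<open>metis less_irrefl mult_eq_0_iff\<close>)
qed

lemma kkt_limit_point:
  fixes q :: "real^'n \<Rightarrow> real^'m"
  assumes g: "C2 g" and q: "\<And>i. C2 (\<lambda>x. q x $ i)"
    and kkt: "\<And>k. kkt g q c (u k) (v k) (l k)"
    and u: "u \<longlonglongrightarrow> a" and v: "v \<longlonglongrightarrow> 0" and l: "l \<longlonglongrightarrow> \<mu>"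
  shows "kkt g q c a 0 \<mu>"
proof -
  have G: "(\<lambda>k. grad f (u k)) \<longlonglongrightarrow> grad f a" if "C2 f" for f :: "real^'n \<Rightarrow> real"
    by (rule continuous_on_tendsto_compose[OF C2_continuous(2)[OF that] u]) simp_all
  have Q: "(\<lambda>k. q (u k) $ i) \<longlonglongrightarrow> q a $ i" for i
    by (rule continuous_on_tendsto_compose[OF C2_continuous(1)[OF q] u]) simp_all
  have L: "(\<lambda>k. l k $ i) \<longlonglongrightarrow> \<mu> $ i" for i by (rule tendsto_vec_nth[OF l])
  have a: "a \<in> feasible q"
    using closed_sequentially[OF closed_feasible[OF q] _ u] kkt by (auto simp: kkt_def)
  have "0 \<le> \<mu> $ i" for i
    using kkt by (intro tendsto_lowerbound[OF L]) (auto simp: kkt_def nonneg_orthant_def)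
  then have nn: "\<mu> \<in> nonneg_orthant" by (simp add: nonneg_orthant_def)
  have "(\<lambda>k. l k $ i * q (u k) $ i) \<longlonglongrightarrow> \<mu> $ i * q a $ i" for i
    by (intro tendsto_mult L Q)
  then have comp: "\<mu> $ i * q a $ i = 0" for i
  proof (rule LIMSEQ_unique)
    have "l k $ i * q (u k) $ i = 0" for k using kkt[of k] unfolding kkt_def by blast
    then show "(\<lambda>k. l k $ i * q (u k) $ i) \<longlonglongrightarrow> 0" by (simp only: tendsto_const)
  qed
  have "(\<lambda>k. grad g (u k) + comb_grad q (u k) (l k)) \<longlonglongrightarrow> grad g a + comb_grad q a \<mu>"
    unfolding comb_grad_def by (intro tendsto_intros G g q L)
  then have stat: "grad g a + comb_grad q a \<mu> = 0"
    using kkt v LIMSEQ_unique by (auto simp: kkt_def)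
  have "norm \<mu> \<le> c * norm (0 - grad g a)"
  proof (rule tendsto_le[OF sequentially_bot])
    show "(\<lambda>k. c * norm (v k - grad g (u k))) \<longlonglongrightarrow> c * norm (0 - grad g a)"
      by (intro tendsto_intros v G g)
    show "(\<lambda>k. norm (l k)) \<longlonglongrightarrow> norm \<mu>" by (intro tendsto_intros l)
  qed (use kkt in \<open>auto simp: kkt_def\<close>)
  with a nn comp stat show ?thesis by (simp add: kkt_def)
qed

text \<open>
  This is where the union over critical directions in \<open>Delta\<close> comes from: the direction \<open>w\<close> from which
  the points \<open>u k\<close> approach \<open>a\<close> is critical, and the limit multiplier \<open>\<mu>\<close> is optimal in the linear
  program of \<open>w\<close>. Indeed \<open>\<mu>\<close> is complementary to \<open>q (u k)\<close> for large \<open>k\<close>, because its positive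
  components come from positive components of \<open>l k\<close>, whereas any other multiplier \<open>\<nu>\<close> has
  \<open>\<nu> \<bullet> q (u k) \<le> 0\<close>. As \<open>\<nu> - \<mu>\<close> annihilates the value and the gradients of \<open>q\<close> at \<open>a\<close>, the second-order
  term of \<open>(\<nu> - \<mu>) \<bullet> q\<close> along \<open>w\<close> is all that remains, and it is nonpositive.
\<close>

lemma kkt_limit_direction:
  fixes q :: "real^'n \<Rightarrow> real^'m"
  assumes g: "C2 g" and q: "\<And>i. C2 (\<lambda>x. q x $ i)" and c: "c \<le> \<gamma>"
    and kkt: "\<And>k. kkt g q c (u k) (v k) (l k)"
    and u: "u \<longlonglongrightarrow> a" and v: "v \<longlonglongrightarrow> 0" and l: "l \<longlonglongrightarrow> \<mu>"
    and ua: "\<And>k. u k \<noteq> a"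
    and w: "(\<lambda>k. (u k - a) /\<^sub>R norm (u k - a)) \<longlonglongrightarrow> w"
  shows "w \<in> sosc_subspace q a \<mu>" and "\<mu> \<in> Delta g q \<gamma> a"
proof -
  have lim: "kkt g q c a 0 \<mu>" by (rule kkt_limit_point[OF g q kkt u v l])
  have "(\<lambda>k. norm ((u k - a) /\<^sub>R norm (u k - a))) \<longlonglongrightarrow> norm w" by (rule tendsto_norm[OF w])
  then have w0: "w \<noteq> 0" using ua LIMSEQ_unique[OF tendsto_const] by fastforce
  have evact: "\<forall>\<^sub>F k in sequentially. q (u k) $ i = 0" if "i \<in> pos_indices \<mu>" for i
    using eventually_active[OF l that, of q u] kkt by (auto simp: kkt_def elim: eventually_mono)
  show sub: "w \<in> sosc_subspace q a \<mu>"
  proof -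
    have "grad (\<lambda>y. q y $ i) a \<bullet> w = 0" if i: "i \<in> pos_indices \<mu>" for i
    proof (rule LIMSEQ_unique[OF first_order_limit[OF q u tendsto_const w] tendsto_eventually])
      have "q a $ i = 0" using lim i by (force simp: kkt_def pos_indices_def)
      with evact[OF i] show "\<forall>\<^sub>F k in sequentially. (q (u k) $ i - q a $ i) / norm (u k - a) = 0"
        by (auto elim: eventually_mono)
    qed
    then show ?thesis by (simp add: sosc_subspace_def)
  qed
  have tan: "w \<in> tangent_cone (feasible q) a"
    unfolding tangent_cone_def
  proof (intro CollectI exI conjI allI)
    show "(\<lambda>k. norm (u k - a)) \<longlonglongrightarrow> 0" using tendsto_norm[OF LIM_zero[OF u]] by simp
    show "a + norm (u k - a) *\<^sub>R ((u k - a) /\<^sub>R norm (u k - a)) \<in> feasible q" for k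
      using kkt[of k] ua[of k] by (simp add: kkt_def)
  qed (use w ua in auto)
  have "comb_grad q a \<mu> \<bullet> w = 0"
    unfolding comb_grad_inner
  proof (rule sum.neutral, rule ballI)
    fix i show "\<mu> $ i * (grad (\<lambda>y. q y $ i) a \<bullet> w) = 0"
      using sub lim by (cases "\<mu> $ i = 0")
        (auto simp: sosc_subspace_def pos_indices_def kkt_def nonneg_orthant_def order_less_le)
  qed
  moreover have cg: "comb_grad q a \<mu> = - grad g a"
    using lim by (simp add: kkt_def eq_neg_iff_add_eq_0 add.commute)
  ultimately have crit: "w \<in> critical_cone q a (- grad g a)"
    using tan by (simp add: critical_cone_def)
  have mult: "\<mu> \<in> multipliers q a (- grad g a)"
    using lim cg by (simp add: multipliers_iff[OF q] kkt_def)
  have "w \<bullet> (hessian (\<lambda>y. \<nu> \<bullet> q y) a *v w) \<le> w \<bullet> (hessian (\<lambda>y. \<mu> \<bullet> q y) a *v w)"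
    if \<nu>: "\<nu> \<in> multipliers q a (- grad g a)" for \<nu>
  proof -
    have "(\<lambda>k. ((\<nu> - \<mu>) \<bullet> q (u k) - (\<nu> - \<mu>) \<bullet> q a - comb_grad q a (\<nu> - \<mu>) \<bullet> (u k - a))
       / (norm (u k - a))\<^sup>2) \<longlonglongrightarrow> (hessian (\<lambda>y. (\<nu> - \<mu>) \<bullet> q y) a *v w) \<bullet> w / 2"
      by (rule comb_second_order_limit[OF q tendsto_const u tendsto_const w])
    moreover have "\<forall>\<^sub>F k in sequentially. ((\<nu> - \<mu>) \<bullet> q (u k) - (\<nu> - \<mu>) \<bullet> q a
       - comb_grad q a (\<nu> - \<mu>) \<bullet> (u k - a)) / (norm (u k - a))\<^sup>2 \<le> 0"
    proof -
      have "\<forall>\<^sub>F k in sequentially. \<forall>i. i \<in> pos_indices \<mu> \<longrightarrow> q (u k) $ i = 0"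
        using evact by (intro eventually_all_finite) (auto simp: eventually_conj_iff)
      then show ?thesis
      proof eventually_elim
        case (elim k)
        have "\<mu> $ i * q (u k) $ i = 0" for i
          using elim mult by (cases "\<mu> $ i = 0")
            (auto simp: pos_indices_def multipliers_def nonneg_orthant_def order_less_le)
        then have "\<mu> \<bullet> q (u k) = 0" by (rule complementary_inner)
        moreover have "\<nu> \<bullet> q (u k) \<le> 0"
          using \<nu> kkt[of k] by (intro nonneg_inner_feasible) (auto simp: multipliers_def kkt_def)
        moreover have "\<mu> \<bullet> q a = 0" "\<nu> \<bullet> q a = 0"
          using mult \<nu> by (auto simp: multipliers_iff[OF q] intro!: complementary_inner)
        moreover have "comb_grad q a (\<nu> - \<mu>) = 0"
          using mult \<nu> by (simp add: multipliers_iff[OF q] linear_diff[OF linear_comb_grad])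
        ultimately show ?case by (simp add: inner_diff_left divide_nonpos_nonneg)
      qed
    qed
    ultimately have "(hessian (\<lambda>y. (\<nu> - \<mu>) \<bullet> q y) a *v w) \<bullet> w / 2 \<le> 0"
      by (intro tendsto_upperbound) auto
    moreover have "(hessian (\<lambda>y. (\<nu> - \<mu>) \<bullet> q y) a *v w) \<bullet> w
      = (hessian (\<lambda>y. \<nu> \<bullet> q y) a *v w) \<bullet> w - (hessian (\<lambda>y. \<mu> \<bullet> q y) a *v w) \<bullet> w"
      unfolding hessian_comb[OF q] quad_comb by (simp add: left_diff_distrib sum_subtractf)
    ultimately show ?thesis by (simp add: inner_commute)
  qed
  then have "\<mu> \<in> dir_multipliers q a (- grad g a) w"
    using mult by (auto simp: dir_multipliers_def is_arg_min_def not_less)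
  moreover have "norm \<mu> \<le> \<gamma> * norm (grad g a)"
    using lim mult_right_mono[OF c norm_ge_zero[of "grad g a"]] by (simp add: kkt_def)
  ultimately show "\<mu> \<in> Delta g q \<gamma> a"
    using crit w0 by (auto simp: Delta_def)
qed

lemma direction_subsequence:
  fixes x u :: "nat \<Rightarrow> real^'n"
  assumes "\<And>k. x k \<noteq> u k"
  obtains r z where "strict_mono r" "norm z = 1"
    "(\<lambda>k. (x (r k) - u (r k)) /\<^sub>R norm (x (r k) - u (r k))) \<longlonglongrightarrow> z"
proof -
  have "compact (sphere (0::real^'n) 1)" by simp
  moreover have "\<forall>k. (x k - u k) /\<^sub>R norm (x k - u k) \<in> sphere 0 1"
    using assms by simp
  ultimately obtain z r where "z \<in> sphere 0 1" "strict_mono r"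
    "((\<lambda>k. (x k - u k) /\<^sub>R norm (x k - u k)) \<circ> r) \<longlonglongrightarrow> z"
    unfolding compact_def by meson
  with that[of r z] show thesis by (simp add: o_def)
qed

lemma kkt_cluster:
  fixes q :: "real^'n \<Rightarrow> real^'m"
  assumes g: "C2 g" and q: "\<And>i. C2 (\<lambda>x. q x $ i)" and c: "c \<le> \<gamma>"
    and kkt: "\<And>k. kkt g q c (u k) (v k) (l k)"
    and u: "u \<longlonglongrightarrow> a" and v: "v \<longlonglongrightarrow> 0" and ua: "\<And>k. u k \<noteq> a"
  obtains r \<mu> w where "strict_mono r" "(\<lambda>k. l (r k)) \<longlonglongrightarrow> \<mu>"
    "(\<lambda>k. (u (r k) - a) /\<^sub>R norm (u (r k) - a)) \<longlonglongrightarrow> w"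
    "norm w = 1" "w \<in> sosc_subspace q a \<mu>" "\<mu> \<in> Delta g q \<gamma> a" "kkt g q c a 0 \<mu>"
proof -
  have "(\<lambda>k. grad g (u k)) \<longlonglongrightarrow> grad g a"
    by (rule continuous_on_tendsto_compose[OF C2_continuous(2)[OF g] u]) simp_all
  then have "(\<lambda>k. c * norm (v k - grad g (u k))) \<longlonglongrightarrow> c * norm (0 - grad g a)"
    by (intro tendsto_intros v)
  then have "Bseq (\<lambda>k. c * norm (v k - grad g (u k)))"
    by (intro convergent_imp_Bseq convergentI)
  then obtain M where "\<And>k. norm (c * norm (v k - grad g (u k))) \<le> M"
    by (auto simp: Bseq_def)
  moreover have "norm (l k) \<le> c * norm (v k - grad g (u k))" for k
    using kkt by (simp add: kkt_def)
  ultimately have "norm (l k) \<le> M" for k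
    by (metis abs_ge_self order_trans real_norm_def)
  then have "bounded (range l)" by (auto simp: bounded_iff)
  then obtain \<mu> r where r: "strict_mono r" "(l \<circ> r) \<longlonglongrightarrow> \<mu>"
    using bounded_imp_convergent_subsequence by blast
  obtain r' w where r': "strict_mono r'" "norm w = 1"
    "(\<lambda>k. (u (r (r' k)) - a) /\<^sub>R norm (u (r (r' k)) - a)) \<longlonglongrightarrow> w"
    using direction_subsequence[of "\<lambda>k. u (r k)" "\<lambda>k. a"] ua by auto
  have R: "strict_mono (r \<circ> r')" using r(1) r'(1) by (rule strict_mono_o)
  have l': "(\<lambda>k. l ((r \<circ> r') k)) \<longlonglongrightarrow> \<mu>"
    using LIMSEQ_subseq_LIMSEQ[OF r(2) r'(1)] by (simp add: o_def)
  have u': "(\<lambda>k. u ((r \<circ> r') k)) \<longlonglongrightarrow> a" and v': "(\<lambda>k. v ((r \<circ> r') k)) \<longlonglongrightarrow> 0"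
    using LIMSEQ_subseq_LIMSEQ[OF u R] LIMSEQ_subseq_LIMSEQ[OF v R] by (simp_all add: o_def)
  have w': "(\<lambda>k. (u ((r \<circ> r') k) - a) /\<^sub>R norm (u ((r \<circ> r') k) - a)) \<longlonglongrightarrow> w"
    using r'(3) by simp
  show thesis
    by (rule that[OF R l' w' r'(2)
        kkt_limit_direction[OF g q c kkt u' v' l' ua w'] kkt_limit_point[OF g q kkt u' v' l']])
qed

section \<open>Quadratic growth near stationary points\<close>

text \<open>
  Suppose that growth with constant \<open>1 / (2 \<kappa>)\<close> fails for points \<open>u\<close>, \<open>x\<close> tending to \<open>a\<close>. The excess
  \<open>g x - g u - v \<bullet> (x - u)\<close> is the second-order remainder of the Lagrangian minus the nonpositive term \<open>l \<bullet> q x\<close>. With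
  \<open>z\<close> a limit of the directions of \<open>x - u\<close> and \<open>\<mu>\<close> a limit of the multipliers, two cases arise. If some
  constraint with \<open>\<mu>\<^sub>i > 0\<close> has nonzero slope along \<open>z\<close>, then \<open>-l \<bullet> q x\<close> is of the first order in
  \<open>\<parallel>x - u\<parallel>\<close> and dominates. Otherwise \<open>z\<close> lies in \<open>sosc_subspace q a \<mu>\<close>, and the second-order condition
  decides. The condition \<open>u \<noteq> a\<close> is what provides the direction that places \<open>\<mu>\<close> in \<open>Delta\<close>.
\<close>

lemma kkt_growth:
  fixes q :: "real^'n \<Rightarrow> real^'m"
  assumes g: "C2 g" and q: "\<And>i. C2 (\<lambda>x. q x $ i)" and c: "c \<le> \<gamma>" and \<kappa>: "0 < \<kappa>"
    and soc: "\<And>l w. l \<in> Delta g q \<gamma> a \<Longrightarrow> w \<noteq> 0 \<Longrightarrow> w \<in> sosc_subspace q a l \<Longrightarrow>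
           lagr_quad g q a l w > 1 / \<kappa> * (norm w)\<^sup>2"
  obtains \<epsilon> where "0 < \<epsilon>"
    "\<And>u v l x. kkt g q c u v l \<Longrightarrow> u \<noteq> a \<Longrightarrow> dist u a < \<epsilon> \<Longrightarrow> norm v < \<epsilon> \<Longrightarrow>
       x \<in> feasible q \<Longrightarrow> dist x a < \<epsilon> \<Longrightarrow>
       g u + v \<bullet> (x - u) + (norm (x - u))\<^sup>2 / (2 * \<kappa>) \<le> g x"
proof -
  have "\<exists>\<epsilon>>0. \<forall>u v l x. kkt g q c u v l \<longrightarrow> u \<noteq> a \<longrightarrow> dist u a < \<epsilon> \<longrightarrow> norm v < \<epsilon> \<longrightarrow>
       x \<in> feasible q \<longrightarrow> dist x a < \<epsilon> \<longrightarrow>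
       g u + v \<bullet> (x - u) + (norm (x - u))\<^sup>2 / (2 * \<kappa>) \<le> g x"
  proof (rule ccontr)
    assume "\<not> ?thesis"
    then have "\<exists>u v l x. kkt g q c u v l \<and> u \<noteq> a \<and> dist u a < e \<and> norm v < e \<and>
       x \<in> feasible q \<and> dist x a < e \<and>
       g x < g u + v \<bullet> (x - u) + (norm (x - u))\<^sup>2 / (2 * \<kappa>)" if "0 < e" for e
      using that by (meson not_le)
    then have "\<forall>k. \<exists>u v l x. kkt g q c u v l \<and> u \<noteq> a \<and> dist u a < inverse (Suc k) \<and>
       norm v < inverse (Suc k) \<and> x \<in> feasible q \<and> dist x a < inverse (Suc k) \<and>
       g x < g u + v \<bullet> (x - u) + (norm (x - u))\<^sup>2 / (2 * \<kappa>)"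
      by simp
    then obtain u v l x where kkt: "\<And>k. kkt g q c (u k) (v k) (l k)" and ua: "\<And>k. u k \<noteq> a"
      and u1: "\<And>k. dist (u k) a < inverse (Suc k)" and v1: "\<And>k. norm (v k) < inverse (Suc k)"
      and xf: "\<And>k. x k \<in> feasible q" and x1: "\<And>k. dist (x k) a < inverse (Suc k)"
      and lt: "\<And>k. g (x k) < g (u k) + v k \<bullet> (x k - u k) + (norm (x k - u k))\<^sup>2 / (2 * \<kappa>)"
      by metis
    have inv: "(\<lambda>k. inverse (real (Suc k))) \<longlonglongrightarrow> 0" by (rule LIMSEQ_inverse_real_of_nat)
    have u: "u \<longlonglongrightarrow> a" and x: "x \<longlonglongrightarrow> a"
      unfolding tendsto_dist_iff[of u] tendsto_dist_iff[of x]
      by (rule tendsto_sandwich[OF _ _ tendsto_const inv];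
          use u1 x1 in \<open>auto intro!: always_eventually less_imp_le\<close>)+
    have v: "v \<longlonglongrightarrow> 0"
      by (rule Lim_null_comparison[OF _ inv])
        (use v1 in \<open>auto intro!: always_eventually less_imp_le\<close>)
    have xu: "x k \<noteq> u k" for k using lt[of k] by auto
    obtain r \<mu> w where r: "strict_mono r" and l1: "(\<lambda>k. l (r k)) \<longlonglongrightarrow> \<mu>"
      and w: "(\<lambda>k. (u (r k) - a) /\<^sub>R norm (u (r k) - a)) \<longlonglongrightarrow> w" "norm w = 1"
        "w \<in> sosc_subspace q a \<mu>"
      and \<mu>: "\<mu> \<in> Delta g q \<gamma> a" and lim: "kkt g q c a 0 \<mu>"
      by (rule kkt_cluster[OF g q c kkt u v ua], rule that)
    obtain r' z where r': "strict_mono r'" and z1: "norm z = 1"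
      and z0: "(\<lambda>k. (x (r (r' k)) - u (r (r' k))) /\<^sub>R norm (x (r (r' k)) - u (r (r' k)))) \<longlonglongrightarrow> z"
      using direction_subsequence[of "\<lambda>k. x (r k)" "\<lambda>k. u (r k)"] xu by auto
    define s where "s = (\<lambda>k. r (r' k))"
    have s: "strict_mono s" unfolding s_def using r r' by (simp add: strict_mono_def)
    define U V L X where "U = (\<lambda>k. u (s k))" and "V = (\<lambda>k. v (s k))"
      and "L = (\<lambda>k. l (s k))" and "X = (\<lambda>k. x (s k))"
    have U: "U \<longlonglongrightarrow> a" and X: "X \<longlonglongrightarrow> a"
      using LIMSEQ_subseq_LIMSEQ[OF u s] LIMSEQ_subseq_LIMSEQ[OF x s]
      by (simp_all add: U_def X_def o_def)
    have L: "L \<longlonglongrightarrow> \<mu>"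
      using LIMSEQ_subseq_LIMSEQ[OF l1 r'] by (simp add: L_def s_def o_def)
    have Z: "(\<lambda>k. (X k - U k) /\<^sub>R norm (X k - U k)) \<longlonglongrightarrow> z"
      using z0 by (simp add: X_def U_def s_def)
    have K: "kkt g q c (U k) (V k) (L k)" and XF: "X k \<in> feasible q" and N: "0 < norm (X k - U k)"
      and LT: "g (X k) < g (U k) + V k \<bullet> (X k - U k) + (norm (X k - U k))\<^sup>2 / (2 * \<kappa>)" for k
      using kkt xf xu lt by (simp_all add: U_def V_def L_def X_def)
    define R where "R = (\<lambda>k. (g (X k) - g (U k) + (L k \<bullet> q (X k) - L k \<bullet> q (U k))
       - (grad g (U k) + comb_grad q (U k) (L k)) \<bullet> (X k - U k)) / (norm (X k - U k))\<^sup>2)"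
    have Rlim: "R \<longlonglongrightarrow> lagr_quad g q a \<mu> z / 2"
      unfolding R_def by (rule lagrangian_second_order_limit[OF g q L X U Z])
    have LU: "L k $ i * q (U k) $ i = 0" for k i using K[of k] unfolding kkt_def by blast
    \<comment> \<open>This restates the failure of growth, divided by the squared distance.\<close>
    have R_lt: "R k < L k \<bullet> q (X k) / (norm (X k - U k))\<^sup>2 + 1 / (2 * \<kappa>)" for k
    proof -
      have "L k \<bullet> q (U k) = 0" by (rule complementary_inner) (rule LU)
      moreover have "grad g (U k) + comb_grad q (U k) (L k) = V k"
        using K[of k] by (simp add: kkt_def)
      ultimately have "R k = (g (X k) - g (U k) + L k \<bullet> q (X k) - V k \<bullet> (X k - U k))
          / (norm (X k - U k))\<^sup>2"
        by (simp add: R_def)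
      also have "\<dots> < (L k \<bullet> q (X k) + (norm (X k - U k))\<^sup>2 / (2 * \<kappa>)) / (norm (X k - U k))\<^sup>2"
        using LT[of k] N[of k] by (intro divide_strict_right_mono) auto
      also have "\<dots> = L k \<bullet> q (X k) / (norm (X k - U k))\<^sup>2 + 1 / (2 * \<kappa>)"
        using N[of k] by (simp add: add_divide_distrib)
      finally show ?thesis .
    qed
    have LX: "L k $ i * q (X k) $ i \<le> 0" for k i
      using K[of k] XF[of k] by (auto simp: kkt_def nonneg_orthant_def feasible_def
          intro: mult_nonneg_nonpos)
    have "R k \<le> 1 / (2 * \<kappa>)" for k
    proof -
      have "L k \<bullet> q (X k) \<le> 0"
        using K[of k] XF[of k] by (intro nonneg_inner_feasible) (auto simp: kkt_def)
      then have "L k \<bullet> q (X k) / (norm (X k - U k))\<^sup>2 \<le> 0" by (simp add: divide_nonpos_nonneg)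
      then show ?thesis using R_lt[of k] by linarith
    qed
    then have "lagr_quad g q a \<mu> z / 2 \<le> 1 / (2 * \<kappa>)"
      by (intro tendsto_upperbound[OF Rlim]) auto
    then have le: "lagr_quad g q a \<mu> z \<le> 1 / \<kappa>" by simp
    have "z \<in> sosc_subspace q a \<mu>"
    proof -
      have "grad (\<lambda>y. q y $ i) a \<bullet> z = 0" if i: "i \<in> pos_indices \<mu>" for i
      proof -
        let ?b = "\<mu> $ i * (grad (\<lambda>y. q y $ i) a \<bullet> z)"
        have act: "\<forall>\<^sub>F k in sequentially. 0 < L k $ i \<and> q (U k) $ i = 0"
          by (rule eventually_active[OF L i]) (rule LU)
        have "(\<lambda>k. L k $ i * ((q (X k) $ i - q (U k) $ i) / norm (X k - U k))) \<longlonglongrightarrow> ?b"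
          by (intro tendsto_mult tendsto_vec_nth L first_order_limit[OF q X U Z])
        \<comment> \<open>The bounded remainder quotient leaves no room for a first-order contribution of any single constraint.\<close>
        moreover have "(\<lambda>k. L k $ i * ((q (X k) $ i - q (U k) $ i) / norm (X k - U k))) \<longlonglongrightarrow> 0"
        proof (rule tendsto_sandwich)
          have "(\<lambda>k. norm (X k - U k)) \<longlonglongrightarrow> 0"
            using tendsto_norm[OF tendsto_diff[OF X U]] by simp
          then have "(\<lambda>k. norm (X k - U k) * (R k - 1 / (2 * \<kappa>)))
             \<longlonglongrightarrow> 0 * (lagr_quad g q a \<mu> z / 2 - 1 / (2 * \<kappa>))"
            by (intro tendsto_intros Rlim)
          then show "(\<lambda>k. norm (X k - U k) * (R k - 1 / (2 * \<kappa>))) \<longlonglongrightarrow> 0" by simp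
          show "\<forall>\<^sub>F k in sequentially. norm (X k - U k) * (R k - 1 / (2 * \<kappa>))
             \<le> L k $ i * ((q (X k) $ i - q (U k) $ i) / norm (X k - U k))"
            using act
          proof eventually_elim
            case (elim k)
            let ?n = "norm (X k - U k)"
            have "L k \<bullet> q (X k) \<le> L k $ i * q (X k) $ i"
            proof -
              have "L k \<bullet> q (X k) = L k $ i * q (X k) $ i + (\<Sum>j\<in>UNIV - {i}. L k $ j * q (X k) $ j)"
                by (simp add: inner_vec_def sum.remove[of UNIV i])
              moreover have "(\<Sum>j\<in>UNIV - {i}. L k $ j * q (X k) $ j) \<le> 0"
                by (intro sum_nonpos LX)
              ultimately show ?thesis by linarith
            qed
            then have "L k \<bullet> q (X k) / ?n\<^sup>2 \<le> L k $ i * q (X k) $ i / ?n\<^sup>2"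
              by (intro divide_right_mono) auto
            then have "R k - 1 / (2 * \<kappa>) \<le> L k $ i * q (X k) $ i / ?n\<^sup>2"
              using R_lt[of k] by linarith
            then have "?n * (R k - 1 / (2 * \<kappa>)) \<le> ?n * (L k $ i * q (X k) $ i / ?n\<^sup>2)"
              by (intro mult_left_mono) auto
            also have "\<dots> = L k $ i * (q (X k) $ i / ?n)"
              using N[of k] by (simp add: power2_eq_square)
            finally show ?case using elim by simp
          qed
          show "\<forall>\<^sub>F k in sequentially. L k $ i * ((q (X k) $ i - q (U k) $ i) / norm (X k - U k)) \<le> 0"
            using act
          proof eventually_elim
            case (elim k)
            then show ?case
              using LX[of k i] N[of k] by (simp add: divide_nonpos_pos)
          qed
        qed simp
        ultimately have "?b = 0" by (rule LIMSEQ_unique)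
        then show ?thesis using i by (simp add: pos_indices_def)
      qed
      then show ?thesis by (simp add: sosc_subspace_def)
    qed
    then have "lagr_quad g q a \<mu> z > 1 / \<kappa> * (norm z)\<^sup>2"
      using z1 by (intro soc[OF \<mu>]) auto
    with le z1 show False by simp
  qed
  then show thesis using that by blast
qed

text \<open>
  A limit direction of such points at \<open>a\<close> lies in \<open>sosc_subspace q a \<mu>\<close>, so the Lagrangian with the
  limit multiplier \<open>\<mu>\<close>, which is stationary in \<open>a\<close> and bounds \<open>g\<close> from below on the feasible set,
  grows quadratically along it.
\<close>

lemma kkt_value_greater:
  fixes q :: "real^'n \<Rightarrow> real^'m"
  assumes g: "C2 g" and q: "\<And>i. C2 (\<lambda>x. q x $ i)" and c: "c \<le> \<gamma>"
    and soc: "\<And>l w. l \<in> Delta g q \<gamma> a \<Longrightarrow> w \<noteq> 0 \<Longrightarrow> w \<in> sosc_subspace q a l \<Longrightarrow>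
           lagr_quad g q a l w > 0"
  obtains \<epsilon> where "0 < \<epsilon>"
    "\<And>u v l. kkt g q c u v l \<Longrightarrow> u \<noteq> a \<Longrightarrow> dist u a < \<epsilon> \<Longrightarrow> norm v < \<epsilon> \<Longrightarrow> g a < g u"
proof -
  have "\<exists>\<epsilon>>0. \<forall>u v l. kkt g q c u v l \<longrightarrow> u \<noteq> a \<longrightarrow> dist u a < \<epsilon> \<longrightarrow> norm v < \<epsilon> \<longrightarrow> g a < g u"
  proof (rule ccontr)
    assume "\<not> ?thesis"
    then have "\<exists>u v l. kkt g q c u v l \<and> u \<noteq> a \<and> dist u a < e \<and> norm v < e \<and> g u \<le> g a"
      if "0 < e" for e
      using that by (meson not_le)
    then have "\<forall>k. \<exists>u v l. kkt g q c u v l \<and> u \<noteq> a \<and> dist u a < inverse (Suc k) \<and>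
       norm v < inverse (Suc k) \<and> g u \<le> g a"
      by simp
    then obtain u v l where kkt: "\<And>k. kkt g q c (u k) (v k) (l k)" and ua: "\<And>k. u k \<noteq> a"
      and u1: "\<And>k. dist (u k) a < inverse (Suc k)" and v1: "\<And>k. norm (v k) < inverse (Suc k)"
      and le: "\<And>k. g (u k) \<le> g a"
      by metis
    have inv: "(\<lambda>k. inverse (real (Suc k))) \<longlonglongrightarrow> 0" by (rule LIMSEQ_inverse_real_of_nat)
    have u: "u \<longlonglongrightarrow> a"
      unfolding tendsto_dist_iff[of u]
      by (rule tendsto_sandwich[OF _ _ tendsto_const inv])
        (use u1 in \<open>auto intro!: always_eventually less_imp_le\<close>)
    have v: "v \<longlonglongrightarrow> 0"
      by (rule Lim_null_comparison[OF _ inv])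
        (use v1 in \<open>auto intro!: always_eventually less_imp_le\<close>)
    obtain r \<mu> w where r: "strict_mono r" and l1: "(\<lambda>k. l (r k)) \<longlonglongrightarrow> \<mu>"
      and w: "(\<lambda>k. (u (r k) - a) /\<^sub>R norm (u (r k) - a)) \<longlonglongrightarrow> w" "norm w = 1"
        "w \<in> sosc_subspace q a \<mu>"
      and \<mu>: "\<mu> \<in> Delta g q \<gamma> a" and lim: "kkt g q c a 0 \<mu>"
      by (rule kkt_cluster[OF g q c kkt u v ua], rule that)
    have U: "(\<lambda>k. u (r k)) \<longlonglongrightarrow> a"
      using LIMSEQ_subseq_LIMSEQ[OF u r] by (simp add: o_def)
    have "lagr_quad g q a \<mu> w / 2 \<le> 0"
    proof (rule tendsto_upperbound[OF lagrangian_second_order_limit[OF g q tendsto_const U tendsto_const w(1)]])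
      have "\<mu> \<bullet> q a = 0" using lim unfolding kkt_def by (intro complementary_inner) blast
      moreover have "grad g a + comb_grad q a \<mu> = 0" using lim by (simp add: kkt_def)
      moreover have "\<mu> \<bullet> q (u (r k)) \<le> 0" for k
        using lim kkt[of "r k"] by (intro nonneg_inner_feasible) (auto simp: kkt_def)
      ultimately show "\<forall>\<^sub>F k in sequentially. (g (u (r k)) - g a + (\<mu> \<bullet> q (u (r k)) - \<mu> \<bullet> q a)
          - (grad g a + comb_grad q a \<mu>) \<bullet> (u (r k) - a)) / (norm (u (r k) - a))\<^sup>2 \<le> 0"
        using le by (intro always_eventually allI divide_nonpos_nonneg) (auto simp: add_nonpos_nonpos)
    qed simp
    moreover have "lagr_quad g q a \<mu> w > 0" using w by (intro soc[OF \<mu>]) auto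
    ultimately show False by simp
  qed
  then show thesis using that by blast
qed

section \<open>The untilted problem\<close>

text \<open>
  On the feasible set the Lagrangian minorizes \<open>g\<close>, with equality in \<open>a\<close>, where its gradient vanishes.
\<close>

lemma stationary_first_order:
  fixes q :: "real^'n \<Rightarrow> real^'m"
  assumes g: "C2 g" and q: "\<And>i. C2 (\<lambda>x. q x $ i)" and stat: "stationary g q a"
    and \<epsilon>: "0 < \<epsilon>"
  obtains \<delta> where "0 < \<delta>"
    "\<And>x. x \<in> feasible q \<Longrightarrow> dist x a < \<delta> \<Longrightarrow> g a - \<epsilon> * norm (x - a) \<le> g x"
proof -
  obtain l where l: "l \<in> nonneg_orthant" "grad (\<lambda>y. lagrangian g q y l) a = 0"
    "\<forall>i. l $ i * q a $ i = 0"
    using stat unfolding stationary_def by blast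
  have "((\<lambda>y. g y + l \<bullet> q y) has_derivative
      (\<lambda>h. h \<bullet> grad g a + h \<bullet> comb_grad q a l)) (at a)"
    by (intro has_derivative_add C2_derivatives(1)[OF g] comb_has_derivative[OF q])
  moreover have "h \<bullet> grad g a + h \<bullet> comb_grad q a l = 0" for h
    using l(2) by (simp add: grad_lagrangian[OF q g] inner_add_right[symmetric])
  ultimately have "((\<lambda>y. g y + l \<bullet> q y) has_derivative (\<lambda>h. 0)) (at a)" by simp
  then obtain \<delta> where \<delta>: "0 < \<delta>" "\<And>y. norm (y - a) < \<delta> \<Longrightarrow>
      \<bar>g y + l \<bullet> q y - (g a + l \<bullet> q a)\<bar> \<le> \<epsilon> * norm (y - a)"
    using \<epsilon> unfolding has_derivative_at_alt real_norm_def by force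
  moreover have "l \<bullet> q a = 0" by (rule complementary_inner) (use l(3) in blast)
  moreover have "l \<bullet> q x \<le> 0" if "x \<in> feasible q" for x
    by (rule nonneg_inner_feasible[OF l(1) that])
  ultimately show thesis by (intro that[of \<delta>]) (force simp: dist_norm)+
qed

text \<open>
  Stationary points near \<open>a\<close> have larger values by \<open>kkt_value_greater\<close>, but a feasible point \<open>x\<close> with
  \<open>g x \<le> g a\<close> need not be stationary. As in Ekeland's principle, it is replaced by a minimizer \<open>u\<close> of \<open>g\<close>
  plus a quadratic penalty for leaving \<open>x\<close>: first-order stationarity of \<open>a\<close> makes \<open>x\<close> almost minimal at
  the scale \<open>r\<close> of its distance to \<open>a\<close>, so a small penalty suffices to keep \<open>u\<close> within \<open>r / 2\<close> of \<open>x\<close>.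
  The gradient of the penalty is a small tilt, and \<open>u\<close> is stationary for it.
\<close>

lemma strict_local_min:
  fixes q :: "real^'n \<Rightarrow> real^'m"
  assumes g: "C2 g" and q: "\<And>i. C2 (\<lambda>x. q x $ i)" and stat: "stationary g q a"
    and c: "0 < c" "c \<le> \<gamma>" and U: "open U" "a \<in> U"
    and mscq: "\<And>y. y \<in> U \<Longrightarrow> infdist y (feasible q) \<le> c * infdist (q y) nonpos_orthant"
    and soc: "\<And>l w. l \<in> Delta g q \<gamma> a \<Longrightarrow> w \<noteq> 0 \<Longrightarrow> w \<in> sosc_subspace q a l \<Longrightarrow>
           lagr_quad g q a l w > 0"
  obtains \<delta> where "0 < \<delta>"
    "\<And>x. x \<in> feasible q \<Longrightarrow> x \<noteq> a \<Longrightarrow> dist x a < \<delta> \<Longrightarrow> g a < g x"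
proof -
  obtain \<epsilon> where \<epsilon>: "0 < \<epsilon>" and greater: "\<And>u v l. kkt g q c u v l \<Longrightarrow> u \<noteq> a \<Longrightarrow>
      dist u a < \<epsilon> \<Longrightarrow> norm v < \<epsilon> \<Longrightarrow> g a < g u"
    using kkt_value_greater[OF g q c(2) soc] by blast
  define \<eta> where "\<eta> = \<epsilon> / 16"
  have \<eta>: "0 < \<eta>" using \<epsilon> by (simp add: \<eta>_def)
  obtain \<delta> where \<delta>: "0 < \<delta>"
    and lower: "\<And>x. x \<in> feasible q \<Longrightarrow> dist x a < \<delta> \<Longrightarrow> g a - \<eta> * norm (x - a) \<le> g x"
    using stationary_first_order[OF g q stat \<eta>] by blast
  obtain \<rho> where \<rho>: "0 < \<rho>" "ball a \<rho> \<subseteq> U" using U openE by blast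
  have "g a < g x" if x: "x \<in> feasible q" "x \<noteq> a"
    and near: "dist x a < min (\<delta> / 2) (min (\<epsilon> / 2) (\<rho> / 2))" for x
  proof (rule ccontr)
    assume "\<not> g a < g x"
    then have le: "g x \<le> g a" by simp
    define r where "r = dist x a"
    have r: "0 < r" "2 * r < \<delta>" "2 * r < \<epsilon>" "2 * r < \<rho>" using x near by (auto simp: r_def)
    \<comment> \<open>The minimizer saves at most \<open>2 \<eta> r\<close> in \<open>g\<close>; the factor 8 turns this into a distance of at most \<open>r / 2\<close> from \<open>x\<close>, at which the penalty has a gradient of norm at most \<open>8 \<eta>\<close>.\<close>
    define \<phi> where "\<phi> = (\<lambda>y. g y + 8 * \<eta> / r * ((y - x) \<bullet> (y - x)))"
    let ?S = "feasible q \<inter> cball a (2 * r)"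
    have "compact ?S" using closed_feasible[OF q] by (intro closed_Int_compact) auto
    moreover have "x \<in> ?S" using x r by (simp add: r_def dist_commute)
    moreover have "continuous_on ?S \<phi>"
      unfolding \<phi>_def
      by (intro continuous_intros continuous_on_subset[OF C2_continuous(1)[OF g]]) auto
    ultimately obtain u where u: "u \<in> ?S" and min: "\<And>y. y \<in> ?S \<Longrightarrow> \<phi> u \<le> \<phi> y"
      using continuous_attains_inf[of ?S \<phi>] by blast
    have "\<phi> u \<le> g x" using min[OF \<open>x \<in> ?S\<close>] by (simp add: \<phi>_def)
    then have \<phi>u: "\<phi> u \<le> g a" using le by simp
    have ua: "dist u a \<le> 2 * r" using u by (simp add: dist_commute)
    have "g a - \<eta> * norm (u - a) \<le> g u" using u ua r by (intro lower) auto
    moreover have "\<eta> * norm (u - a) \<le> \<eta> * (2 * r)"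
      using ua \<eta> by (intro mult_left_mono) (auto simp: dist_norm)
    ultimately have "8 * \<eta> / r * ((u - x) \<bullet> (u - x)) \<le> \<eta> * (2 * r)"
      using \<phi>u by (simp add: \<phi>_def)
    then have "(8 * \<eta> / r) * (norm (u - x))\<^sup>2 \<le> (8 * \<eta> / r) * (r / 2)\<^sup>2"
      using r(1) by (simp add: dot_square_norm power2_eq_square)
    then have "(norm (u - x))\<^sup>2 \<le> (r / 2)\<^sup>2" using \<eta> r(1) by (simp add: field_simps)
    then have ux: "norm (u - x) \<le> r / 2" using r(1) by (simp add: power2_le_iff_abs_le)
    have tri: "dist u a \<le> dist u x + r" "r \<le> dist u x + dist u a"
      unfolding r_def by (metis dist_triangle) (metis dist_commute dist_triangle)
    have une: "u \<noteq> a" using tri(2) ux r(1) by (auto simp: dist_norm)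
    define v where "v = - (16 * \<eta> / r) *\<^sub>R (u - x)"
    have "norm v = (16 * \<eta> / r) * norm (u - x)" using \<eta> r(1) by (simp add: v_def)
    also have "\<dots> \<le> (16 * \<eta> / r) * (r / 2)" using ux \<eta> r(1) by (intro mult_left_mono) auto
    also have "\<dots> < \<epsilon>" using r(1) \<epsilon> by (simp add: \<eta>_def)
    finally have v: "norm v < \<epsilon>" .
    have deriv: "(\<phi> has_derivative (\<lambda>h. h \<bullet> (grad g u - v))) (at u)"
      unfolding \<phi>_def v_def
      using r(1) by (auto intro!: derivative_eq_intros C2_derivatives(1)[OF g]
          simp: inner_diff_right inner_add_right inner_commute algebra_simps)
    have locmin: "\<phi> u \<le> \<phi> y" if "y \<in> feasible q" "dist y u < r / 2" for y
    proof (rule min)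
      have "dist y a \<le> dist y u + dist u a" by (rule dist_triangle)
      with tri(1) ux that show "y \<in> ?S" by (auto simp: dist_norm norm_minus_commute)
    qed
    have "u \<in> U" using \<rho>(2) ua r(4) by (auto simp: dist_commute)
    moreover have "u \<in> feasible q" "0 < r / 2" using u r(1) by auto
    ultimately obtain l where "kkt g q c u v l"
      using local_min_kkt[OF q _ c(1) U(1) _ mscq deriv _ locmin] by blast
    then have "g a < g u" using greater une v ua r(3) by auto
    moreover have "g u \<le> \<phi> u" using \<eta> r(1) by (simp add: \<phi>_def)
    ultimately show False using \<phi>u by simp
  qed
  then show thesis
    by (rule that[of "min (\<delta> / 2) (min (\<epsilon> / 2) (\<rho> / 2))", rotated]) (use \<delta> \<epsilon> \<rho>(1) in auto)
qed

section \<open>Tilt stability\<close>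

lemma minimizers_converge:
  fixes x :: "nat \<Rightarrow> 'a::real_inner"
  assumes S: "compact S" and g: "continuous_on S g" and v: "v \<longlonglongrightarrow> v0"
    and x: "\<And>k. x k \<in> S" and min: "\<And>k y. y \<in> S \<Longrightarrow> g (x k) - v k \<bullet> x k \<le> g y - v k \<bullet> y"
    and uniq: "\<And>z. z \<in> S \<Longrightarrow> (\<And>y. y \<in> S \<Longrightarrow> g z - v0 \<bullet> z \<le> g y - v0 \<bullet> y) \<Longrightarrow> z = x0"
  shows "x \<longlonglongrightarrow> x0"
proof (rule ccontr)
  assume "\<not> x \<longlonglongrightarrow> x0"
  then obtain e where e: "0 < e" and "\<exists>\<^sub>F k in sequentially. \<not> dist (x k) x0 < e"
    unfolding tendsto_iff not_eventually[symmetric] by blast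
  then have "infinite {k. \<not> dist (x k) x0 < e}"
    by (simp add: frequently_cofinite[symmetric] cofinite_eq_sequentially)
  then obtain r :: "nat \<Rightarrow> nat" where r: "strict_mono r" "\<And>k. \<not> dist (x (r k)) x0 < e"
    using infinite_enumerate by blast
  obtain z r' where z: "z \<in> S" and r': "strict_mono r'" and "((\<lambda>k. x (r k)) \<circ> r') \<longlonglongrightarrow> z"
    using S x unfolding compact_def by meson
  then have lim: "(\<lambda>k. x (r (r' k))) \<longlonglongrightarrow> z" by (simp add: o_def)
  have vlim: "(\<lambda>k. v (r (r' k))) \<longlonglongrightarrow> v0"
    using LIMSEQ_subseq_LIMSEQ[OF LIMSEQ_subseq_LIMSEQ[OF v r(1)] r'] by (simp add: o_def)
  have glim: "(\<lambda>k. g (x (r (r' k)))) \<longlonglongrightarrow> g z"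
    using continuous_on_tendsto_compose[OF g lim z] x by simp
  have "z = x0"
  proof (rule uniq[OF z])
    fix y assume y: "y \<in> S"
    have "(\<lambda>k. g (x (r (r' k))) - v (r (r' k)) \<bullet> x (r (r' k))) \<longlonglongrightarrow> g z - v0 \<bullet> z"
      by (intro tendsto_intros glim vlim lim)
    moreover have "(\<lambda>k. g y - v (r (r' k)) \<bullet> y) \<longlonglongrightarrow> g y - v0 \<bullet> y"
      by (intro tendsto_intros vlim)
    ultimately show "g z - v0 \<bullet> z \<le> g y - v0 \<bullet> y"
      using min[OF y] by (intro LIMSEQ_le) auto
  qed
  with lim e have "\<forall>\<^sub>F k in sequentially. dist (x (r (r' k))) x0 < e" by (auto dest: tendstoD)
  with r(2) show False by simp
qed

text \<open>
  On the segment from a parameter with value \<open>a\<close> to one with another value, let \<open>p T\<close> be the last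
  parameter at which the value is \<open>a\<close>. Beyond it the estimate is available, continuity extends it to
  \<open>p T\<close>, and the value there is the same as at the starting point.
\<close>

lemma lipschitz_off_value:
  fixes s :: "'a::real_normed_vector \<Rightarrow> 'b::metric_space"
  assumes V: "convex V" and s: "continuous_on V s" and \<kappa>: "0 \<le> \<kappa>"
    and off: "\<And>v w. v \<in> V \<Longrightarrow> w \<in> V \<Longrightarrow> s v \<noteq> a \<Longrightarrow> s w \<noteq> a \<Longrightarrow>
      dist (s v) (s w) \<le> \<kappa> * dist v w"
  shows "\<kappa>-lipschitz_on V s"
proof -
  have one: "dist (s v) (s w) \<le> \<kappa> * dist v w"
    if v: "v \<in> V" and w: "w \<in> V" and sv: "s v = a" and sw: "s w \<noteq> a" for v w
  proof -
    \<comment> \<open>The path is traversed backwards, from \<open>w\<close> to \<open>v\<close>, so that the sought parameter is the first one.\<close>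
    define p where "p = (\<lambda>t::real. w + t *\<^sub>R (v - w))"
    have pV: "p t \<in> V" if "t \<in> {0..1}" for t
    proof -
      have "p t = (1 - t) *\<^sub>R w + t *\<^sub>R v" by (simp add: p_def algebra_simps)
      then show ?thesis using convexD[OF V w v, of "1 - t" t] that by simp
    qed
    have pd: "dist (p t) w = \<bar>t\<bar> * dist v w" for t by (simp add: p_def dist_norm)
    have cont: "continuous_on {0..1} (\<lambda>t. s (p t))"
      by (rule continuous_on_compose2[OF s]) (auto simp: p_def intro!: continuous_intros pV[unfolded p_def])
    have "closed {t \<in> {0..1}. s (p t) = a}"
      using continuous_closed_preimage_constant[OF cont] by simp
    then have "compact {t \<in> {0..1}. s (p t) = a}"
      by (auto simp: compact_eq_bounded_closed intro: bounded_subset[of "{0..1::real}"])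
    moreover have "1 \<in> {t \<in> {0..1}. s (p t) = a}" using sv by (simp add: p_def)
    ultimately obtain T where T: "T \<in> {0..1}" "s (p T) = a"
      and least: "\<And>t. t \<in> {0..1} \<Longrightarrow> s (p t) = a \<Longrightarrow> T \<le> t"
      using compact_attains_inf[of "{t \<in> {0..1}. s (p t) = a}"] by blast
    have "T \<noteq> 0" using T(2) sw by (auto simp: p_def)
    then have T0: "0 < T" "T \<le> 1" using T(1) by auto
    define t where "t = (\<lambda>k. T * (1 - inverse (real (Suc k))))"
    have "t \<longlonglongrightarrow> T * (1 - 0)"
      unfolding t_def by (intro tendsto_intros LIMSEQ_inverse_real_of_nat)
    then have tlim: "t \<longlonglongrightarrow> T" by simp
    have t: "0 \<le> t k" "t k < T" "t k \<in> {0..1}" for k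
    proof -
      have i: "0 < inverse (real (Suc k))" "inverse (real (Suc k)) \<le> 1"
        by (simp_all add: field_simps)
      show "0 \<le> t k" unfolding t_def using T0 i by (intro mult_nonneg_nonneg) auto
      moreover show "t k < T"
        unfolding t_def using T0 i mult_strict_left_mono[of "1 - inverse (real (Suc k))" 1 T] by simp
      ultimately show "t k \<in> {0..1}" using T0 by simp
    qed
    have "dist (s (p (t k))) (s w) \<le> \<kappa> * dist v w" for k
    proof -
      have "s (p (t k)) \<noteq> a" using least[OF t(3)] t(2) by (metis not_le)
      then have "dist (s (p (t k))) (s w) \<le> \<kappa> * dist (p (t k)) w"
        using pV[OF t(3)] w sw by (intro off) auto
      also have "\<dots> \<le> \<kappa> * dist v w"
        unfolding pd using t[of k] by (intro mult_left_mono[OF _ \<kappa>]) (auto intro: mult_left_le_one_le)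
      finally show ?thesis .
    qed
    moreover have "(\<lambda>k. s (p (t k))) \<longlonglongrightarrow> s (p T)"
      using continuous_on_tendsto_compose[OF cont tlim T(1)] t(3) by simp
    ultimately have "dist (s (p T)) (s w) \<le> \<kappa> * dist v w"
      by (intro tendsto_upperbound[of "\<lambda>k. dist (s (p (t k))) (s w)"] tendsto_intros) auto
    then show ?thesis using T(2) sv by simp
  qed
  show ?thesis
  proof (rule lipschitz_onI[OF _ \<kappa>])
    fix v w assume "v \<in> V" "w \<in> V"
    then show "dist (s v) (s w) \<le> \<kappa> * dist v w"
      using one[of v w] one[of w v] off[of v w] \<kappa>
      by (cases "s v = a"; cases "s w = a") (auto simp: dist_commute)
  qed
qed

text \<open>
  Minimizers of the tilted problems lie in the interior of the localizing ball when the tilt is small,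
  since the untilted problem has the strict minimizer \<open>a\<close>. They are thus stationary and, unless equal to
  \<open>a\<close>, satisfy the growth estimate. One such estimate shows that a tilt has only one minimizer; two of
  them, added, give the Lipschitz bound.
\<close>

theorem tilt_stable_second_order:
  fixes q :: "real^'n \<Rightarrow> real^'m"
  assumes g: "C2 g" and q: "\<And>i. C2 (\<lambda>x. q x $ i)" and stat: "stationary g q a"
    and \<kappa>: "0 < \<kappa>" and c: "mscq_const q a c" "c \<le> \<gamma>"
    and soc: "\<And>l w. l \<in> Delta g q \<gamma> a \<Longrightarrow> w \<noteq> 0 \<Longrightarrow> w \<in> sosc_subspace q a l \<Longrightarrow>
           lagr_quad g q a l w > 1 / \<kappa> * (norm w)\<^sup>2"
  shows "tilt_stable g q a \<kappa>"
proof -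
  obtain U where c0: "0 < c" and U: "open U" "a \<in> U"
    and mscq: "\<And>y. y \<in> U \<Longrightarrow> infdist y (feasible q) \<le> c * infdist (q y) nonpos_orthant"
    using c(1) unfolding mscq_const_def by blast
  have af: "a \<in> feasible q" using stat by (simp add: stationary_def)
  obtain \<epsilon> where \<epsilon>: "0 < \<epsilon>" and growth: "\<And>u v l x. kkt g q c u v l \<Longrightarrow> u \<noteq> a \<Longrightarrow>
      dist u a < \<epsilon> \<Longrightarrow> norm v < \<epsilon> \<Longrightarrow> x \<in> feasible q \<Longrightarrow> dist x a < \<epsilon> \<Longrightarrow>
      g u + v \<bullet> (x - u) + (norm (x - u))\<^sup>2 / (2 * \<kappa>) \<le> g x"
    using kkt_growth[OF g q c(2) \<kappa> soc] by blast
  have "lagr_quad g q a l w > 0"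
    if "l \<in> Delta g q \<gamma> a" "w \<noteq> 0" "w \<in> sosc_subspace q a l" for l w
  proof -
    have "0 \<le> 1 / \<kappa> * (norm w)\<^sup>2" using \<kappa> by simp
    then show ?thesis using soc[OF that] by linarith
  qed
  then obtain \<delta> where \<delta>: "0 < \<delta>"
    and strict: "\<And>x. x \<in> feasible q \<Longrightarrow> x \<noteq> a \<Longrightarrow> dist x a < \<delta> \<Longrightarrow> g a < g x"
    using strict_local_min[OF g q stat c0 c(2) U mscq] by blast
  obtain \<rho> where \<rho>: "0 < \<rho>" "ball a \<rho> \<subseteq> U" using U openE by blast
  define r where "r = min (\<delta> / 2) (min (\<epsilon> / 2) (\<rho> / 2))"
  have r: "0 < r" "r < \<delta>" "r < \<epsilon>" "r < \<rho>" using \<delta> \<epsilon> \<rho>(1) by (auto simp: r_def)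
  define S where "S = feasible q \<inter> cball a r"
  have S: "compact S"
    unfolding S_def using closed_feasible[OF q] by (intro closed_Int_compact) auto
  have aS: "a \<in> S" using af r(1) by (simp add: S_def)
  have gS: "continuous_on S g" by (rule continuous_on_subset[OF C2_continuous(1)[OF g]]) simp
  define M where "M = (\<lambda>v. {x \<in> S. \<forall>y\<in>S. g x - v \<bullet> x \<le> g y - v \<bullet> y})"
  have M: "tilt_argmin g q a r v = M v" for v
    by (auto simp: tilt_argmin_def M_def S_def is_arg_min_def not_less)
  have M_ne: "M v \<noteq> {}" for v
  proof -
    have "continuous_on S (\<lambda>x. g x - v \<bullet> x)" by (intro continuous_intros gS)
    then show ?thesis using continuous_attains_inf[OF S, of "\<lambda>x. g x - v \<bullet> x"] aS
      by (auto simp: M_def)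
  qed
  have M0: "x = a" if "x \<in> M 0" for x
  proof (rule ccontr)
    assume "x \<noteq> a"
    moreover have "x \<in> feasible q" "dist x a < \<delta>"
      using that r(2) by (auto simp: M_def S_def dist_commute)
    ultimately have "g a < g x" by (intro strict)
    then show False using that aS by (auto simp: M_def)
  qed
  have "\<exists>\<eta>>0. \<forall>v. norm v < \<eta> \<longrightarrow> (\<forall>x\<in>M v. dist x a < r)"
  proof (rule ccontr)
    assume "\<not> ?thesis"
    then have "\<exists>v x. norm v < \<eta> \<and> x \<in> M v \<and> r \<le> dist x a" if "0 < \<eta>" for \<eta>
      using that by (meson not_le)
    then have "\<forall>k. \<exists>v x. norm v < inverse (Suc k) \<and> x \<in> M v \<and> r \<le> dist x a" by simp
    then obtain v x where v1: "\<And>k. norm (v k) < inverse (Suc k)" and xM: "\<And>k. x k \<in> M (v k)"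
      and far: "\<And>k. r \<le> dist (x k) a"
      by metis
    have v: "v \<longlonglongrightarrow> 0"
      by (rule Lim_null_comparison[OF _ LIMSEQ_inverse_real_of_nat])
        (use v1 in \<open>auto intro!: always_eventually less_imp_le\<close>)
    have "x \<longlonglongrightarrow> a"
      using xM M0 by (intro minimizers_converge[OF S gS v]) (auto simp: M_def)
    then have "\<forall>\<^sub>F k in sequentially. dist (x k) a < r" using r(1) by (rule tendstoD)
    with far show False by (simp add: not_less[symmetric])
  qed
  then obtain \<eta> where \<eta>: "0 < \<eta>" and interior: "\<And>v x. norm v < \<eta> \<Longrightarrow> x \<in> M v \<Longrightarrow> dist x a < r"
    by blast
  define V where "V = ball (0 :: real^'n) (min \<eta> \<epsilon>)"
  have M_growth: "g x + v \<bullet> (y - x) + (norm (y - x))\<^sup>2 / (2 * \<kappa>) \<le> g y"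
    if v: "v \<in> V" and x: "x \<in> M v" "x \<noteq> a" and y: "y \<in> S" for v x y
  proof -
    have xr: "dist x a < r" using v x by (intro interior[of v]) (auto simp: V_def)
    have xf: "x \<in> feasible q" using x by (simp add: M_def S_def)
    have xU: "x \<in> U" using \<rho>(2) xr r(4) by (auto simp: dist_commute)
    have deriv: "((\<lambda>y. g y - v \<bullet> y) has_derivative (\<lambda>h. h \<bullet> (grad g x - v))) (at x)"
      by (auto intro!: derivative_eq_intros C2_derivatives(1)[OF g]
          simp: inner_diff_right inner_commute)
    have min: "g x - v \<bullet> x \<le> g z - v \<bullet> z" if "z \<in> feasible q" "dist z x < r - dist x a" for z
    proof -
      have "dist z a \<le> dist z x + dist x a" by (rule dist_triangle)
      then have "z \<in> S" using that by (simp add: S_def dist_commute)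
      then show ?thesis using x by (simp add: M_def)
    qed
    have "0 < r - dist x a" using xr by simp
    then obtain l where "kkt g q c x v l"
      using local_min_kkt[OF q xf c0 U(1) xU mscq deriv _ min] by blast
    then show ?thesis
      using x(2) xr y v r(3) by (intro growth) (auto simp: V_def S_def dist_commute)
  qed
  have M_unique: "x = x'" if v: "v \<in> V" and x: "x \<in> M v" "x' \<in> M v" for v x x'
  proof -
    have "x = x'" if "x \<noteq> a" "x \<in> M v" "x' \<in> M v" for x x'
    proof -
      have "g x + v \<bullet> (x' - x) + (norm (x' - x))\<^sup>2 / (2 * \<kappa>) \<le> g x'"
        using that v by (intro M_growth) (auto simp: M_def)
      moreover have "g x' - v \<bullet> x' \<le> g x - v \<bullet> x" using that by (simp add: M_def)
      ultimately have "(norm (x' - x))\<^sup>2 / (2 * \<kappa>) \<le> 0" by (simp add: inner_diff_right)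
      then show ?thesis using \<kappa> by (simp add: divide_le_0_iff)
    qed
    then show ?thesis using x by metis
  qed
  \<comment> \<open>The choice is forced for \<open>v \<in> V\<close>.\<close>
  define s where "s = (\<lambda>v. SOME x. x \<in> M v)"
  have sM: "s v \<in> M v" for v unfolding s_def some_in_eq by (rule M_ne)
  have Ms: "M v = {s v}" if "v \<in> V" for v using sM M_unique[OF that] by blast
  have "continuous_on V s"
    unfolding continuous_on_sequentially
  proof (intro allI ballI impI, elim conjE)
    fix v v0 assume v0: "v0 \<in> V" and v: "\<forall>k::nat. v k \<in> V" "v \<longlonglongrightarrow> v0"
    show "(s \<circ> v) \<longlonglongrightarrow> s v0"
      using sM Ms[OF v0] by (intro minimizers_converge[OF S gS v(2)]) (auto simp: M_def)
  qed
  moreover have "convex V" by (simp add: V_def)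
  moreover have "dist (s v) (s w) \<le> \<kappa> * dist v w"
    if v: "v \<in> V" "s v \<noteq> a" and w: "w \<in> V" "s w \<noteq> a" for v w
  proof -
    let ?d = "s v - s w"
    have "s v \<in> S" "s w \<in> S" using sM by (auto simp: M_def)
    then have "g (s v) + v \<bullet> (s w - s v) + (norm ?d)\<^sup>2 / (2 * \<kappa>) \<le> g (s w)"
      "g (s w) + w \<bullet> (s v - s w) + (norm ?d)\<^sup>2 / (2 * \<kappa>) \<le> g (s v)"
      using M_growth[OF v(1) sM v(2), of "s w"] M_growth[OF w(1) sM w(2), of "s v"]
      by (simp_all add: norm_minus_commute)
    then have "(norm ?d)\<^sup>2 / \<kappa> \<le> (v - w) \<bullet> ?d"
      by (simp add: inner_diff_left inner_diff_right)
    also have "\<dots> \<le> norm (v - w) * norm ?d" by (rule norm_cauchy_schwarz)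
    finally have "norm ?d * norm ?d \<le> (\<kappa> * norm (v - w)) * norm ?d"
      using \<kappa> by (simp add: power2_eq_square field_simps)
    then show ?thesis using \<kappa> by (cases "norm ?d = 0") (auto simp: dist_norm)
  qed
  ultimately have "\<kappa>-lipschitz_on V s"
    using \<kappa> by (intro lipschitz_off_value[where a = a]) auto
  moreover have "open V" "0 \<in> V" using \<eta> \<epsilon> by (auto simp: V_def)
  moreover have "s 0 = a" using M0 sM by blast
  ultimately have "\<exists>V s. open V \<and> 0 \<in> V \<and> (\<forall>v\<in>V. tilt_argmin g q a r v = {s v}) \<and>
      \<kappa>-lipschitz_on V s \<and> s 0 = a"
    using Ms M by (intro exI[of _ V] exI[of _ s]) simp
  with \<kappa> af r(1) show ?thesis unfolding tilt_stable_def by blast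
qed

theorem theorem4p9:
  fixes g :: "real^'n \<Rightarrow> real" and q :: "real^'n \<Rightarrow> real^'m"
    and xbar :: "real^'n" and \<kappa> \<gamma> :: real
  assumes "C2 g" and "\<And>i. C2 (\<lambda>x. q x $ i)"
    and "stationary g q xbar"
    and "0 < \<kappa>" and "0 < \<gamma>"
    and "MSCQ q xbar"
    and "ereal \<gamma> > subreg q xbar"
    and "\<And>l w. l \<in> Delta g q \<gamma> xbar \<Longrightarrow> w \<noteq> 0 \<Longrightarrow> w \<in> sosc_subspace q xbar l \<Longrightarrow>
           lagr_quad g q xbar l w > 1 / \<kappa> * (norm w)\<^sup>2"
  shows "tilt_stable g q xbar \<kappa> \<and>
         tilt g q xbar \<le> tilt_bound g q \<gamma> xbar \<and> tilt_bound g q \<gamma> xbar < \<infinity>"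
proof -
  obtain c where c: "mscq_const q xbar c" "c \<le> \<gamma>"
    using assms(7) unfolding subreg_def Inf_less_iff by (auto simp: less_imp_le)
  have stable: "tilt_stable g q xbar \<kappa>'" if "0 < \<kappa>'"
    and "\<And>l w. l \<in> Delta g q \<gamma> xbar \<Longrightarrow> w \<noteq> 0 \<Longrightarrow> w \<in> sosc_subspace q xbar l \<Longrightarrow>
           lagr_quad g q xbar l w > 1 / \<kappa>' * (norm w)\<^sup>2" for \<kappa>'
    by (rule tilt_stable_second_order[OF assms(1,2,3) that(1) c that(2)])
  have pos: "0 < lagr_quad g q xbar l w"
    if "l \<in> Delta g q \<gamma> xbar" "w \<noteq> 0" "w \<in> sosc_subspace q xbar l" for l w
  proof -
    have "0 \<le> 1 / \<kappa> * (norm w)\<^sup>2" using assms(4) by simp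
    then show ?thesis using assms(8)[OF that] by linarith
  qed
  define Q where "Q = {ereal ((norm w)\<^sup>2) / ereal (lagr_quad g q xbar l w) | l w.
                 l \<in> Delta g q \<gamma> xbar \<and> w \<in> sosc_subspace q xbar l}"
  have bound: "tilt_bound g q \<gamma> xbar = (if Q = {} then 0 else Sup Q)"
    unfolding tilt_bound_def Q_def[symmetric] Let_def ..
  \<comment> \<open>The vector 0 contributes the quotient \<open>0 / x = 0\<close>, also when \<open>x = 0\<close>.\<close>
  have zero: "0 \<le> tilt_bound g q \<gamma> xbar"
  proof (cases "Q = {}")
    case False
    then obtain l where "l \<in> Delta g q \<gamma> xbar" by (auto simp: Q_def)
    then have "ereal ((norm (0::real^'n))\<^sup>2) / ereal (lagr_quad g q xbar l 0) \<in> Q"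
      unfolding Q_def sosc_subspace_def by force
    then have "0 \<in> Q" by (simp add: zero_ereal_def[symmetric])
    then show ?thesis using bound False by (simp add: Sup_upper)
  qed (simp add: bound)
  have "x \<le> ereal \<kappa>" if "x \<in> Q" for x
  proof -
    obtain l w where lw: "l \<in> Delta g q \<gamma> xbar" "w \<in> sosc_subspace q xbar l"
      and x: "x = ereal ((norm w)\<^sup>2) / ereal (lagr_quad g q xbar l w)"
      using \<open>x \<in> Q\<close> by (auto simp: Q_def)
    show ?thesis
    proof (cases "w = 0")
      case True
      then show ?thesis using x assms(4) by (simp add: zero_ereal_def[symmetric])
    next
      case False
      then show ?thesis using x pos[OF lw(1) False lw(2)] assms(8)[OF lw(1) False lw(2)] assms(4)
        by (simp add: field_simps)
    qed
  qed
  then have "tilt_bound g q \<gamma> xbar \<le> ereal \<kappa>"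
    using assms(4) by (simp add: bound Sup_least)
  then have fin: "tilt_bound g q \<gamma> xbar < \<infinity>" by auto
  \<comment> \<open>The second-order condition holds with every modulus above the supremum.\<close>
  have "tilt g q xbar \<le> ereal \<kappa>'" if \<kappa>': "tilt_bound g q \<gamma> xbar < ereal \<kappa>'" for \<kappa>'
  proof -
    have \<kappa>0: "0 < \<kappa>'" using zero \<kappa>' by (metis ereal_less(2) order_le_less_trans)
    have "tilt_stable g q xbar \<kappa>'"
    proof (rule stable[OF \<kappa>0])
      fix l w assume lw: "l \<in> Delta g q \<gamma> xbar" "w \<noteq> 0" "w \<in> sosc_subspace q xbar l"
      then have mem: "ereal ((norm w)\<^sup>2) / ereal (lagr_quad g q xbar l w) \<in> Q"
        unfolding Q_def by blast
      then have "ereal ((norm w)\<^sup>2) / ereal (lagr_quad g q xbar l w) \<le> tilt_bound g q \<gamma> xbar"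
        using bound Sup_upper[OF mem] by (metis empty_iff)
      then have "ereal ((norm w)\<^sup>2) / ereal (lagr_quad g q xbar l w) < ereal \<kappa>'"
        using \<kappa>' by (rule order_le_less_trans)
      then show "lagr_quad g q xbar l w > 1 / \<kappa>' * (norm w)\<^sup>2"
        using pos[OF lw] \<kappa>0 by (simp add: field_simps)
    qed
    then show ?thesis unfolding tilt_def by (intro Inf_lower) auto
  qed
  then have "tilt g q xbar \<le> tilt_bound g q \<gamma> xbar"
    by (metis ereal_le_real linorder_not_le ereal_dense2 less_imp_le order.strict_trans2)
  with stable[OF assms(4,8)] fin show ?thesis by blast
qed

end
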